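(* Let $W,V:\mathbb{R}\to\mathbb{R}$ be strictly increasing functions, $W$ càdlàg and $V$ càglàd, continuous at $0$ with $W(0)=V(0)=0$, satisfying $W(x+1)-W(x)=W(1)-W(0)$ and $V(x+1)-V(x)=V(1)-V(0)$ for all $x\in\mathbb{R}$, and let $\Delta_{W,V}:\mathcal{D}_{W,V}(\mathbb{T})\subset L^2_V(\mathbb{T})\to L^2_V(\mathbb{T})$ be the induced $W$-$V$-Laplacian. Let $\{\lambda_i\}_{i\ge1}$ be the non-decreasing sequence of positive eigenvalues (counted according to their multiplicity) of $-\Delta_{W,V}$. Then there exists $\rho\in(0,\frac12]$ such that for some constant $C>0$ $$Cn^{1/\rho}\le\lambda_n\qquad\text{for all } n\ge1.$$ Moreover, $$\sum_{i=1}^{\infty}\frac{1}{\lambda_i^{s}}<\infty\qquad\text{for every } s>\rho.$$ Furthermore, the lower bound is sharp in the sense that it is attained for some $W$ and $V$, i.e. there are strictly increasing functions $W,V:\mathbb{R}\to\mathbb{R}$, $W$ càdlàg and $V$ càglàd, continuous at $0$ with $W(0)=V(0)=0$, satisfying $W(x+1)-W(x)=W(1)-W(0)$ and $V(x+1)-V(x)=V(1)-V(0)$ for all $x\in\mathbb{R}$, for which $\lambda_n$ is of exact order $n^{1/\rho}$ with such a $\rho\in(0,\frac12]$.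
   Context: $\mathbb{T}=\mathbb{R}/\mathbb{Z}$, identified with $[0,1)$. The measures $dW,dV$ are given by $dW((a,b])=W(b)-W(a)$, $dV([a,b))=V(b)-V(a)$. $L^2_V(\mathbb{T})$ is the $L^2$ space of $dV$ and $L^2_{V,0}(\mathbb{T})=\{f\in L^2_V(\mathbb{T}):\int_{\mathbb{T}}f\,dV=0\}$. $\mathcal{D}_{W,V}(\mathbb{T})$ is the set of $f\in L^2_V(\mathbb{T})$ for which there are $a,b\in\mathbb{R}$ and $\mathfrak{f}\in L^2_{V,0}(\mathbb{T})$ with $f(x)=a+bW(x)+\int_{(0,x]}\int_{[0,y)}\mathfrak{f}(s)\,dV(s)\,dW(y)$ and $bW(1)+\int_{(0,1]}\int_{[0,y)}\mathfrak{f}(s)\,dV(s)\,dW(y)=0$; then $\Delta_{W,V}f:=\mathfrak{f}$. Known background: $\Delta_{W,V}$ is self-adjoint on $L^2_V(\mathbb{T})$, $(I-\Delta_{W,V})^{-1}$ is compact, and the eigenvalues of $-\Delta_{W,V}$ form a sequence $0=\lambda_0\le\lambda_1\le\lambda_2\le\cdots\to\infty$, with $0$ simple. *)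

theory Defs
  imports "HOL-Analysis.Analysis"
begin

definition cadlag :: "(real \<Rightarrow> real) \<Rightarrow> bool" where
  "cadlag f \<longleftrightarrow> (\<forall>x. continuous (at_right x) f \<and> (\<exists>l. (f \<longlongrightarrow> l) (at_left x)))"

definition caglad :: "(real \<Rightarrow> real) \<Rightarrow> bool" where
  "caglad f \<longleftrightarrow> (\<forall>x. continuous (at_left x) f \<and> (\<exists>l. (f \<longlongrightarrow> l) (at_right x)))"

definition admissible :: "(real \<Rightarrow> real) \<Rightarrow> (real \<Rightarrow> real) \<Rightarrow> bool" where
  "admissible W V \<longleftrightarrow>
     strict_mono W \<and> strict_mono V \<and> cadlag W \<and> caglad V \<and>
     isCont W 0 \<and> isCont V 0 \<and> W 0 = 0 \<and> V 0 = 0 \<and>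
     (\<forall>x. W (x + 1) - W x = W 1 - W 0) \<and> (\<forall>x. V (x + 1) - V x = V 1 - V 0)"

abbreviation dW :: "(real \<Rightarrow> real) \<Rightarrow> real measure" where
  "dW W \<equiv> interval_measure W"

text \<open>The library measure \<^const>\<open>interval_measure\<close> requires a right-continuous function.
  For left-continuous \<open>V\<close>, the function \<open>x \<mapsto> - V (- x)\<close> is right-continuous, and reflecting its
  measure yields mass \<open>V b - V a\<close> on \<open>[a, b)\<close>; see \<open>emeasure_dV\<close> below.\<close>

definition dV :: "(real \<Rightarrow> real) \<Rightarrow> real measure" where
  "dV V = distr (interval_measure (\<lambda>x. - V (- x))) borel uminus"

lemma emeasure_dW:
  assumes "mono W" "cadlag W" "a \<le> b"
  shows "emeasure (dW W) {a<..b} = ennreal (W b - W a)"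
  using assms by (intro emeasure_interval_measure_Ioc) (auto simp: cadlag_def mono_def)

lemma emeasure_dV:
  assumes "mono V" "caglad V" "a \<le> b"
  shows "emeasure (dV V) {a..<b} = ennreal (V b - V a)"
proof -
  let ?F = "\<lambda>x. - V (- x)"
  have right_cont: "continuous (at_right x) ?F" for x
  proof -
    have "(V \<longlongrightarrow> V (- x)) (at_left (- x))"
      using assms(2) by (simp add: caglad_def continuous_within)
    then have "((\<lambda>y. V (- y)) \<longlongrightarrow> V (- x)) (at_right x)"
      by (simp add: at_left_minus filterlim_filtermap)
    then show ?thesis
      by (simp add: continuous_within tendsto_minus)
  qed
  have "uminus -` {a..<b} = {- b<..- a}"
    by auto
  then have "emeasure (dV V) {a..<b} = emeasure (interval_measure ?F) {- b<..- a}"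
    unfolding dV_def by (subst emeasure_distr) simp_all
  also have "\<dots> = ennreal (V b - V a)"
    using assms right_cont by (subst emeasure_interval_measure_Ioc) (auto simp: mono_def)
  finally show ?thesis .
qed

text \<open>The torus is identified with \<open>[0, 1)\<close>. Elements of the real space \<open>L\<^sup>2\<close> are represented by
  functions on the line of which only the values on \<open>[0, 1)\<close> matter; equality in \<open>L\<^sup>2\<close> is
  equality \<open>dV\<close>-almost everywhere on \<open>[0, 1)\<close>.\<close>

abbreviation torus :: "real set" where
  "torus \<equiv> {0..<1}"

definition L2 :: "(real \<Rightarrow> real) \<Rightarrow> (real \<Rightarrow> real) set" where
  "L2 V = {f. set_borel_measurable (dV V) torus f \<and> set_integrable (dV V) torus (\<lambda>x. (f x)\<^sup>2)}"

definition L2_0 :: "(real \<Rightarrow> real) \<Rightarrow> (real \<Rightarrow> real) set" where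
  "L2_0 V = {f \<in> L2 V. (LINT x:torus|dV V. f x) = 0}"

definition iterated_integral ::
    "(real \<Rightarrow> real) \<Rightarrow> (real \<Rightarrow> real) \<Rightarrow> (real \<Rightarrow> real) \<Rightarrow> real \<Rightarrow> real" where
  "iterated_integral W V g x = (LINT y:{0<..x}|dW W. (LINT s:{0..<y}|dV V. g s))"

text \<open>The graph of the \<open>W\<close>-\<open>V\<close>-Laplacian: \<open>f\<close> belongs to its domain and its value at \<open>f\<close> is \<open>g\<close>.\<close>

definition has_laplacian ::
    "(real \<Rightarrow> real) \<Rightarrow> (real \<Rightarrow> real) \<Rightarrow> (real \<Rightarrow> real) \<Rightarrow> (real \<Rightarrow> real) \<Rightarrow> bool" where
  "has_laplacian W V f g \<longleftrightarrow>
     f \<in> L2 V \<and> g \<in> L2_0 V \<and>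
     (\<exists>a b. (AE x\<in>torus in dV V. f x = a + b * W x + iterated_integral W V g x) \<and>
            b * W 1 + iterated_integral W V g 1 = 0)"

definition eigenspace :: "(real \<Rightarrow> real) \<Rightarrow> (real \<Rightarrow> real) \<Rightarrow> real \<Rightarrow> (real \<Rightarrow> real) set" where
  "eigenspace W V \<mu> = {f. has_laplacian W V f (\<lambda>x. - \<mu> * f x)}"

text \<open>The subspace \<open>E\<close> of \<open>L\<^sup>2\<close> has a basis of \<open>d\<close> elements, all relations being modulo
  \<open>dV\<close>-null sets.\<close>

definition has_dim_L2 :: "(real \<Rightarrow> real) \<Rightarrow> (real \<Rightarrow> real) set \<Rightarrow> nat \<Rightarrow> bool" where
  "has_dim_L2 V E d \<longleftrightarrow>
     (\<exists>e :: nat \<Rightarrow> real \<Rightarrow> real.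
        (\<forall>i<d. e i \<in> E) \<and>
        (\<forall>c :: nat \<Rightarrow> real.
           (AE x\<in>torus in dV V. (\<Sum>i<d. c i * e i x) = 0) \<longrightarrow> (\<forall>i<d. c i = 0)) \<and>
        (\<forall>f\<in>E. \<exists>c :: nat \<Rightarrow> real. AE x\<in>torus in dV V. f x = (\<Sum>i<d. c i * e i x)))"

text \<open>Enumerations start at index \<open>1\<close>, and \<open>lam 0\<close> is irrelevant. For \<open>\<mu> > 0\<close> that is not an
  eigenvalue the eigenspace has dimension \<open>0\<close>, so the last clause says that \<open>\<mu>\<close> does not occur;
  otherwise \<open>\<mu>\<close> occurs exactly as often as its multiplicity.\<close>

definition positive_eigenvalues ::
    "(real \<Rightarrow> real) \<Rightarrow> (real \<Rightarrow> real) \<Rightarrow> (nat \<Rightarrow> real) \<Rightarrow> bool" where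
  "positive_eigenvalues W V lam \<longleftrightarrow>
     (\<forall>i\<ge>1. 0 < lam i) \<and> mono_on {1..} lam \<and>
     (\<forall>\<mu>>0. finite {i. 1 \<le> i \<and> lam i = \<mu>} \<and>
        has_dim_L2 V (eigenspace W V \<mu>) (card {i. 1 \<le> i \<and> lam i = \<mu>}))"

end

theory Submission
  imports Defs
begin

text \<open>Both halves hold with \<open>\<rho> = 1/2\<close>: the eigenvalues grow at least quadratically whatever jumps \<open>W\<close> and
\<open>V\<close> have, and for \<open>W x = V x = x\<close> they grow exactly quadratically. The summability claim follows
from \<open>C * n\<^sup>2 \<le> \<lambda>\<^sub>n\<close> by comparison with \<open>\<Sum> n powr (-2 * s)\<close>.

The lower bound is a Courant--Fischer argument carried out with the eigenfunctions themselves. Write an eigenfunction as \<open>f = a + \<integral>\<^bsub>(0,x]\<^esub> F dW\<close>, where the derivative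
\<open>F\<close> of \<open>f\<close> with respect to \<open>W\<close> is in turn a primitive of \<open>- \<lambda> f\<close> with respect to \<open>dV\<close>.
Green's identity (\<open>green_identity\<close>) gives
\<open>\<integral> F G dW = \<lambda> \<integral> f g dV\<close> for two eigenfunctions \<open>f\<close>, \<open>g\<close>. Hence eigenfunctions of different
eigenvalues are orthogonal, and the energy \<open>\<integral> F\<^sup>2 dW\<close> of any linear combination \<open>f\<close> of
eigenfunctions for eigenvalues at most \<open>\<Lambda>\<close> is at most \<open>\<Lambda> \<integral> f\<^sup>2 dV\<close>.

In the other direction there is a Poincare inequality. Cut the torus at \<open>m\<close> points so that on each
open interval in between the product of the \<open>dW\<close>-mass and the \<open>dV\<close>-mass is at most \<open>\<delta>\<close>.
If \<open>f\<close> vanishes at all these points then \<open>\<integral> f\<^sup>2 dV \<le> \<delta> \<integral> F\<^sup>2 dW\<close>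
(\<open>poincare_vanishing_at_points\<close>). Atoms of \<open>dV\<close> and \<open>dW\<close> do no harm: the large ones become cut points,
where \<open>f\<close> vanishes. Cutting at the quantiles of
\<open>W / W 1 + V / V 1\<close> gives \<open>\<delta> = 4 * V 1 * W 1 / m\<^sup>2\<close> (\<open>small_partition_exists\<close>).

Vanishing at \<open>m\<close> points is \<open>m\<close> linear conditions, so some nontrivial combination of the first
\<open>m + 1\<close> eigenfunctions satisfies them; comparing the two inequalities for it yields
\<open>1 \<le> \<delta> * \<lambda>\<^bsub>m+1\<^esub>\<close>, which is the quadratic bound (\<open>eigenvalue_lower_bound_of_partition\<close>).

For \<open>W x = V x = x\<close> both measures are Lebesgue measure and the eigenvalue equation becomes
\<open>f'' = - \<omega>\<^sup>2 f\<close> with periodic boundary conditions. It has nonzero solutions only if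
\<open>cos \<omega> = 1\<close>, so the positive eigenvalues are \<open>(2 \<pi> k)\<^sup>2\<close> for \<open>k \<ge> 1\<close>, each with
multiplicity two.\<close>

section \<open>Preliminaries from linear algebra and integration\<close>

text \<open>Cauchy--Schwarz on \<open>A\<close>, from the nonnegativity of the quadratic form
  \<open>\<integral>\<^sub>A (c * F - d)\<^sup>2\<close> in \<open>c\<close> and \<open>d\<close>, evaluated at \<open>c = measure M A\<close> and
  \<open>d = \<integral>\<^sub>A F\<close>.\<close>

lemma (in finite_measure) Cauchy_Schwarz_integral_on_set:
  fixes F :: "_ \<Rightarrow> real"
  assumes A: "A \<in> sets M" and F2: "integrable M (\<lambda>x. (F x)\<^sup>2)" and Fi: "integrable M F"
  shows "(\<integral>x. indicator A x * F x \<partial>M)\<^sup>2 \<le> measure M A * (\<integral>x. indicator A x * (F x)\<^sup>2 \<partial>M)"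
proof -
  define S where "S = (\<integral>x. indicator A x * F x \<partial>M)"
  define Q where "Q = (\<integral>x. indicator A x * (F x)\<^sup>2 \<partial>M)"
  have i1: "integrable M (\<lambda>x. indicator A x * F x)" and i2: "integrable M (\<lambda>x. indicator A x * (F x)\<^sup>2)"
    and i0: "integrable M (indicator A :: _ \<Rightarrow> real)"
    using integrable_mult_indicator[OF A Fi] integrable_mult_indicator[OF A F2] A
    by (auto simp: fmeasurable_def less_top[symmetric])
  have quad: "0 \<le> c\<^sup>2 * Q - 2 * c * d * S + d\<^sup>2 * measure M A" for c d
  proof -
    have "0 \<le> (\<integral>x. indicator A x * (c * F x - d)\<^sup>2 \<partial>M)" by (intro Bochner_Integration.integral_nonneg) auto
    also have "\<dots> = (\<integral>x. c\<^sup>2 * (indicator A x * (F x)\<^sup>2) - 2 * c * d * (indicator A x * F x) + d\<^sup>2 * indicator A x \<partial>M)"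
      by (intro Bochner_Integration.integral_cong refl) (simp add: power2_eq_square algebra_simps)
    also have "\<dots> = c\<^sup>2 * Q - 2 * c * d * S + d\<^sup>2 * measure M A"
      unfolding Q_def S_def using i0 i1 i2 A by simp
    finally show ?thesis .
  qed
  show ?thesis
  proof (cases "measure M A = 0")
    case True
    have "AE x in M. indicator A x * F x = 0"
      using True A by (intro AE_I[of _ _ A]) (auto simp: emeasure_eq_measure split: split_indicator_asm)
    then have "S = 0" unfolding S_def by (rule integral_eq_zero_AE)
    then show ?thesis using True by (simp add: S_def)
  next
    case False
    then have pos: "measure M A > 0" using measure_nonneg[of M A] by linarith
    have "0 \<le> measure M A * (measure M A * Q - S\<^sup>2)"
      using quad[of "measure M A" S] by (simp add: power2_eq_square algebra_simps)
    then have "S\<^sup>2 \<le> measure M A * Q" using pos by (simp add: zero_le_mult_iff)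
    then show ?thesis by (simp add: S_def Q_def)
  qed
qed

text \<open>Gaussian elimination: solve the last equation for an unknown \<open>k\<close> that occurs in it,
  substitute into the others, and continue with one equation and one unknown fewer.\<close>

lemma underdetermined_system_nontrivial_solution:
  fixes a :: "'i \<Rightarrow> nat \<Rightarrow> real"
  assumes "finite I" "m < card I"
  shows "\<exists>c. (\<exists>i\<in>I. c i \<noteq> 0) \<and> (\<forall>j<m. (\<Sum>i\<in>I. c i * a i j) = 0)"
  using assms
proof (induction m arbitrary: I a)
  case 0
  then obtain i where "i \<in> I" by fastforce
  then show ?case by (intro exI[of _ "\<lambda>_. 1"]) auto
next
  case (Suc m)
  show ?case
  proof (cases "\<forall>i\<in>I. a i m = 0")
    case True
    from Suc.IH[of I a] Suc.prems obtain c where "\<exists>i\<in>I. c i \<noteq> 0" "\<forall>j<m. (\<Sum>i\<in>I. c i * a i j) = 0" by auto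
    with True show ?thesis by (intro exI[of _ c]) (auto simp: less_Suc_eq)
  next
    case False
    then obtain k where k: "k \<in> I" "a k m \<noteq> 0" by blast
    let ?J = "I - {k}"
    from Suc.IH[of ?J "\<lambda>i j. a i j - a i m / a k m * a k j"] Suc.prems k
    have "\<exists>c. (\<exists>i\<in>?J. c i \<noteq> 0) \<and>
        (\<forall>j<m. (\<Sum>i\<in>?J. c i * (a i j - a i m / a k m * a k j)) = 0)"
      by auto
    then obtain c where
      c: "\<exists>i\<in>?J. c i \<noteq> 0" "\<And>j. j < m \<Longrightarrow> (\<Sum>i\<in>?J. c i * (a i j - a i m / a k m * a k j)) = 0"
      by blast
    define t where "t = - (\<Sum>i\<in>?J. c i * a i m) / a k m"
    have split: "(\<Sum>i\<in>I. (c(k := t)) i * a i j) = t * a k j + (\<Sum>i\<in>?J. c i * a i j)" for j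
      using Suc.prems k by (subst sum.remove[of I k]) auto
    have "(\<Sum>i\<in>I. (c(k := t)) i * a i j) = 0" if "j < Suc m" for j
    proof (cases "j = m")
      case True
      then show ?thesis unfolding split using k by (simp add: t_def)
    next
      case False
      have "0 = (\<Sum>i\<in>?J. c i * a i j - (c i * a i m) * (a k j / a k m))"
        using c(2)[of j] that False by (simp add: algebra_simps)
      also have "\<dots> = (\<Sum>i\<in>?J. c i * a i j) - (\<Sum>i\<in>?J. c i * a i m) * (a k j / a k m)"
        by (simp only: sum_subtractf sum_distrib_right)
      finally show ?thesis unfolding split by (simp add: t_def)
    qed
    moreover have "\<exists>i\<in>I. (c(k := t)) i \<noteq> 0" using c(1) by auto
    ultimately show ?thesis by blast
  qed
qed

lemma integrable_restrict:
  fixes F :: "real \<Rightarrow> real"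
  assumes "integrable K F" "sets K = sets borel" "Measurable.pred borel P"
  shows "integrable K (\<lambda>y. if P y then F y else 0)"
proof (rule Bochner_Integration.integrable_bound[OF assms(1)])
  have [measurable]: "F \<in> borel_measurable borel" "Measurable.pred borel P"
    using assms by (auto simp: measurable_cong_sets[OF assms(2) refl] dest!: borel_measurable_integrable)
  show "(\<lambda>y. if P y then F y else 0) \<in> borel_measurable K"
    unfolding measurable_cong_sets[OF assms(2) refl] by measurable
qed auto

text \<open>Eigenfunctions and their derivatives are bounded, so for finite measures every
  product of them is integrable. Bundling boundedness with measurability gives a class that is closed
  under sums, products and primitives and settles these integrability questions once.\<close>

definition bounded_borel :: "(real \<Rightarrow> real) \<Rightarrow> bool" where
  "bounded_borel f \<longleftrightarrow> f \<in> borel_measurable borel \<and> (\<exists>B. \<forall>x. \<bar>f x\<bar> \<le> B)"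

lemma bounded_borel_const [simp]: "bounded_borel (\<lambda>_. c)"
  by (auto simp: bounded_borel_def)

lemma bounded_borel_add: assumes "bounded_borel f" "bounded_borel g" shows "bounded_borel (\<lambda>x. f x + g x)"
proof -
  from assms obtain A B where AB: "\<And>x. \<bar>f x\<bar> \<le> A" "\<And>x. \<bar>g x\<bar> \<le> B" by (auto simp: bounded_borel_def)
  have "\<bar>f x + g x\<bar> \<le> A + B" for x using AB[of x] by linarith
  then show ?thesis using assms by (auto simp: bounded_borel_def)
qed

lemma bounded_borel_mult: assumes "bounded_borel f" "bounded_borel g" shows "bounded_borel (\<lambda>x. f x * g x)"
proof -
  from assms obtain A B where AB: "\<And>x. \<bar>f x\<bar> \<le> A" "\<And>x. \<bar>g x\<bar> \<le> B" by (auto simp: bounded_borel_def)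
  have "\<bar>f x * g x\<bar> \<le> A * B" for x using AB[of x] by (auto simp: abs_mult intro!: mult_mono order_trans[OF abs_ge_zero AB(1)])
  then show ?thesis using assms by (auto simp: bounded_borel_def)
qed

lemma bounded_borel_sum: "(\<And>i. i \<in> I \<Longrightarrow> bounded_borel (f i)) \<Longrightarrow> bounded_borel (\<lambda>x. \<Sum>i\<in>I. f i x)"
  by (induction I rule: infinite_finite_induct) (auto intro: bounded_borel_add)

lemma integral_square_sum:
  fixes f :: "'i \<Rightarrow> real \<Rightarrow> real"
  assumes "finite J" "\<And>i k. i \<in> J \<Longrightarrow> k \<in> J \<Longrightarrow> integrable K (\<lambda>x. f i x * f k x)"
  shows "(\<integral>x. (\<Sum>i\<in>J. c i * f i x)\<^sup>2 \<partial>K) = (\<Sum>i\<in>J. \<Sum>k\<in>J. c i * c k * (\<integral>x. f i x * f k x \<partial>K))"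
proof -
  have "(\<integral>x. (\<Sum>i\<in>J. c i * f i x)\<^sup>2 \<partial>K) = (\<integral>x. (\<Sum>i\<in>J. \<Sum>k\<in>J. c i * c k * (f i x * f k x)) \<partial>K)"
    by (intro Bochner_Integration.integral_cong refl) (simp add: power2_eq_square sum_product mult_ac)
  also have "\<dots> = (\<Sum>i\<in>J. \<Sum>k\<in>J. c i * c k * (\<integral>x. f i x * f k x \<partial>K))"
    using assms by (subst Bochner_Integration.integral_sum, force)
      (auto intro!: sum.cong simp: Bochner_Integration.integral_sum)
  finally show ?thesis .
qed

section \<open>Green's identity and the Poincare inequality for a pair of measures\<close>

text \<open>The measures \<open>M\<close> and \<open>N\<close> stand for \<open>dV\<close> on \<open>[0, 1)\<close> and \<open>dW\<close> on
  \<open>(0, 1]\<close>, extended by zero to the line. After that extension the two one-sided conventions, for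
  closed primitives \<open>\<integral>\<^bsub>(0,x]\<^esub>\<close> and for open ones \<open>\<integral>\<^bsub>[0,y)\<^esub>\<close>, become the conditions
  \<open>y \<le> x\<close> and \<open>s < y\<close>, which are exactly complementary. This is why integration by parts
  holds below without correction terms at common atoms.\<close>

locale two_finite_measures = M: finite_measure M + N: finite_measure N for M N :: "real measure" +
  assumes sets_M [measurable_cong, simp]: "sets M = sets borel" and sets_N [measurable_cong, simp]: "sets N = sets borel"

begin

sublocale pair_sigma_finite M N ..

lemma borel_M [simp]: "borel_measurable M = borel_measurable borel"
  by (rule measurable_cong_sets) simp_all

lemma borel_N [simp]: "borel_measurable N = borel_measurable borel"
  by (rule measurable_cong_sets) simp_all

definition primitive_N :: "(real \<Rightarrow> real) \<Rightarrow> real \<Rightarrow> real" where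
  "primitive_N F x = (\<integral>y. (if y \<le> x then F y else 0) \<partial>N)"

definition primitive_M :: "(real \<Rightarrow> real) \<Rightarrow> real \<Rightarrow> real" where
  "primitive_M g y = (\<integral>s. (if s < y then g s else 0) \<partial>M)"

lemma primitive_N_measurable [measurable]:
  assumes [measurable]: "F \<in> borel_measurable borel" shows "primitive_N F \<in> borel_measurable borel"
proof -
  have "(\<lambda>x. \<integral>y. (if y \<le> x then F y else 0) \<partial>N) \<in> borel_measurable borel"
    by (rule N.borel_measurable_lebesgue_integral) (simp add: case_prod_beta)
  then show ?thesis by (simp add: primitive_N_def[abs_def])
qed

lemma primitive_M_measurable [measurable]:
  assumes [measurable]: "g \<in> borel_measurable borel" shows "primitive_M g \<in> borel_measurable borel"
proof -
  have "(\<lambda>x. \<integral>s. (if s < x then g s else 0) \<partial>M) \<in> borel_measurable borel"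
    by (rule M.borel_measurable_lebesgue_integral) (simp add: case_prod_beta)
  then show ?thesis by (simp add: primitive_M_def[abs_def])
qed

lemma abs_primitive_N_le: assumes "integrable N F" shows "\<bar>primitive_N F x\<bar> \<le> (\<integral>y. \<bar>F y\<bar> \<partial>N)"
proof -
  have "\<bar>primitive_N F x\<bar> \<le> (\<integral>y. \<bar>if y \<le> x then F y else 0\<bar> \<partial>N)"
    unfolding primitive_N_def by (rule integral_abs_bound)
  also have "\<dots> \<le> (\<integral>y. \<bar>F y\<bar> \<partial>N)"
    using assms by (intro integral_mono integrable_abs integrable_restrict) auto
  finally show ?thesis .
qed

lemma abs_primitive_M_le: assumes "integrable M g" shows "\<bar>primitive_M g y\<bar> \<le> (\<integral>s. \<bar>g s\<bar> \<partial>M)"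
proof -
  have "\<bar>primitive_M g y\<bar> \<le> (\<integral>s. \<bar>if s < y then g s else 0\<bar> \<partial>M)"
    unfolding primitive_M_def by (rule integral_abs_bound)
  also have "\<dots> \<le> (\<integral>s. \<bar>g s\<bar> \<partial>M)"
    using assms by (intro integral_mono integrable_abs integrable_restrict) auto
  finally show ?thesis .
qed

text \<open>Fubini on the region \<open>y \<le> x\<close> turns the left side into
  \<open>\<integral> H(y) (\<integral>\<^bsub>x \<ge> y\<^esub> g dM) dN\<close>, and since \<open>g\<close> has mean zero the inner integral is
  \<open>- \<integral>\<^bsub>x < y\<^esub> g dM\<close>.\<close>

lemma green_identity:
  assumes g: "integrable M g" "(\<integral>x. g x \<partial>M) = 0" and H: "integrable N H"
  shows "(\<integral>x. g x * primitive_N H x \<partial>M) = - (\<integral>y. H y * primitive_M g y \<partial>N)"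
proof -
  have [measurable]: "g \<in> borel_measurable borel" "H \<in> borel_measurable borel"
    using g H by (auto dest!: borel_measurable_integrable)
  have gH: "integrable (M \<Otimes>\<^sub>M N) (\<lambda>(x, y). g x * H y)"
  proof (rule Fubini_integrable)
    show "integrable M (\<lambda>x. \<integral>y. norm (case (x, y) of (x, y) \<Rightarrow> g x * H y) \<partial>N)"
      using g by (simp add: abs_mult)
  qed (use H in auto)
  have int: "integrable (M \<Otimes>\<^sub>M N) (\<lambda>(x, y). if y \<le> x then g x * H y else 0)"
    by (rule Bochner_Integration.integrable_bound[OF gH]) auto
  have "(\<integral>x. g x * primitive_N H x \<partial>M) = (\<integral>x. (\<integral>y. (if y \<le> x then g x * H y else 0) \<partial>N) \<partial>M)"
    
  proof (intro Bochner_Integration.integral_cong refl)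
    fix x
    have "g x * primitive_N H x = (\<integral>y. g x * (if y \<le> x then H y else 0) \<partial>N)"
      unfolding primitive_N_def by (rule integral_mult_right_zero[symmetric])
    then show "g x * primitive_N H x = (\<integral>y. (if y \<le> x then g x * H y else 0) \<partial>N)"
      by (simp add: if_distrib cong: if_cong)
  qed
  also have "\<dots> = (\<integral>y. (\<integral>x. (if y \<le> x then g x * H y else 0) \<partial>M) \<partial>N)"
    by (rule Fubini_integral[OF int, symmetric])
  also have "\<dots> = (\<integral>y. - (H y * primitive_M g y) \<partial>N)"
  proof (intro Bochner_Integration.integral_cong refl)
    fix y
    have "(\<integral>x. (if y \<le> x then g x * H y else 0) \<partial>M)
        = (\<integral>x. H y * (g x - (if x < y then g x else 0)) \<partial>M)"
      by (intro Bochner_Integration.integral_cong refl) auto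
    also have "\<dots> = H y * (0 - primitive_M g y)"
      unfolding primitive_M_def integral_mult_right_zero using g
      by (subst Bochner_Integration.integral_diff) (auto intro!: integrable_restrict)
    finally show "(\<integral>x. (if y \<le> x then g x * H y else 0) \<partial>M) = - (H y * primitive_M g y)" by simp
  qed
  finally show ?thesis by simp
qed

text \<open>An eigenfunction of the negative Laplacian in pointwise form: \<open>r\<close> is the representative
  given by the integral equation and \<open>F\<close> is its \<open>N\<close>-derivative. Working with a function rather
  than a class modulo null sets is what gives a meaning to the value of \<open>r\<close> at a point. The vanishing
  integrals of \<open>r\<close> and \<open>F\<close> are periodicity of \<open>F\<close> and of \<open>r\<close>.\<close>

definition mode :: "real \<Rightarrow> (real \<Rightarrow> real) \<Rightarrow> (real \<Rightarrow> real) \<Rightarrow> bool" where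
  "mode \<mu> r F \<longleftrightarrow> (\<exists>a b. (\<forall>x. r x = a + primitive_N F x) \<and> (\<forall>y. F y = b - \<mu> * primitive_M r y)) \<and>
     integrable M r \<and> (\<integral>x. r x \<partial>M) = 0 \<and> (\<integral>y. F y \<partial>N) = 0"

lemma integrable_bounded_borel:
  assumes "bounded_borel f" shows "integrable M f" "integrable N f"
proof -
  from assms obtain B where B: "\<And>x. \<bar>f x\<bar> \<le> B" by (auto simp: bounded_borel_def)
  show "integrable M f" by (rule M.integrable_const_bound[of _ B]) (use B assms in \<open>auto simp: bounded_borel_def\<close>)
  show "integrable N f" by (rule N.integrable_const_bound[of _ B]) (use B assms in \<open>auto simp: bounded_borel_def\<close>)
qed

lemma bounded_borel_primitive_M: "integrable M g \<Longrightarrow> bounded_borel (primitive_M g)"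
  unfolding bounded_borel_def using abs_primitive_M_le[of g] borel_measurable_integrable[of M g] by auto

lemma bounded_borel_primitive_N: "integrable N g \<Longrightarrow> bounded_borel (primitive_N g)"
  unfolding bounded_borel_def using abs_primitive_N_le[of g] borel_measurable_integrable[of N g] by auto

lemma mode_bounded:
  assumes "mode \<mu> r F" shows "bounded_borel r" "bounded_borel F"
proof -
  from assms obtain a b where eq: "r = (\<lambda>x. a + primitive_N F x)" "F = (\<lambda>y. b + (- \<mu>) * primitive_M r y)"
    and r: "integrable M r" unfolding mode_def fun_eq_iff by auto
  show F: "bounded_borel F"
    by (subst eq(2)) (intro bounded_borel_add bounded_borel_mult bounded_borel_const bounded_borel_primitive_M r)
  show "bounded_borel r"
    by (subst eq(1)) (intro bounded_borel_add bounded_borel_const bounded_borel_primitive_N integrable_bounded_borel F)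
qed

text \<open>The weak form of the eigenvalue equation. The constants of integration in \<open>F\<close> and
  \<open>h\<close> drop out because \<open>H\<close> and \<open>r\<close> have mean zero.\<close>

lemma mode_energy:
  assumes r: "mode \<mu> r F" and h: "mode \<mu>' h H"
  shows "(\<integral>y. F y * H y \<partial>N) = \<mu> * (\<integral>x. r x * h x \<partial>M)"
proof -
  note bd = mode_bounded[OF r] mode_bounded[OF h]
  from r obtain b where b: "\<And>y. F y = b - \<mu> * primitive_M r y" and r0: "(\<integral>x. r x \<partial>M) = 0" "integrable M r"
    by (auto simp: mode_def)
  from h obtain a where a: "\<And>x. h x = a + primitive_N H x" and H0: "(\<integral>y. H y \<partial>N) = 0" by (auto simp: mode_def)
  note int [simp] = integrable_bounded_borel[OF bd(1)] integrable_bounded_borel[OF bd(4)]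
    integrable_bounded_borel[OF bounded_borel_mult[OF bd(4) bounded_borel_primitive_M[OF r0(2)]]]
    integrable_bounded_borel[OF bounded_borel_mult[OF bd(1) bounded_borel_primitive_N[OF integrable_bounded_borel(2)[OF bd(4)]]]]
  have "(\<integral>y. F y * H y \<partial>N) = (\<integral>y. b * H y - \<mu> * (H y * primitive_M r y) \<partial>N)"
    by (intro Bochner_Integration.integral_cong refl) (simp add: b algebra_simps)
  also have "\<dots> = - \<mu> * (\<integral>y. H y * primitive_M r y \<partial>N)" using H0 by simp
  also have "\<dots> = \<mu> * (\<integral>x. r x * primitive_N H x \<partial>M)" using green_identity[OF r0(2,1), of H] by simp
  also have "(\<integral>x. r x * primitive_N H x \<partial>M) = (\<integral>x. a * r x + r x * primitive_N H x \<partial>M)" using r0 by simp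
  also have "\<dots> = (\<integral>x. r x * h x \<partial>M)"
    by (intro Bochner_Integration.integral_cong refl) (simp add: a algebra_simps)
  finally show ?thesis .
qed

text \<open>The energy is symmetric, so it equals both \<open>\<mu>\<close> and \<open>\<mu>'\<close> times the inner
  product.\<close>

lemma mode_orthogonal:
  assumes "mode \<mu> r F" "mode \<mu>' h H" "\<mu> \<noteq> \<mu>'"
  shows "(\<integral>x. r x * h x \<partial>M) = 0"
  using mode_energy[OF assms(1,2)] mode_energy[OF assms(2,1)] assms(3) by (simp add: mult.commute)

lemma primitive_N_diff:
  assumes F: "bounded_borel F" and "t \<le> x"
  shows "primitive_N F x - primitive_N F t = (\<integral>y. indicator {t<..x} y * F y \<partial>N)"
proof -
  have [measurable]: "F \<in> borel_measurable borel" using F by (simp add: bounded_borel_def)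
  have "primitive_N F x - primitive_N F t = (\<integral>y. (if y \<le> x then F y else 0) - (if y \<le> t then F y else 0) \<partial>N)"
    unfolding primitive_N_def using integrable_bounded_borel(2)[OF F]
    by (subst Bochner_Integration.integral_diff) (auto intro!: integrable_restrict)
  also have "\<dots> = (\<integral>y. indicator {t<..x} y * F y \<partial>N)"
    using \<open>t \<le> x\<close> by (intro Bochner_Integration.integral_cong refl) (auto split: split_indicator)
  finally show ?thesis .
qed

text \<open>The points \<open>t j\<close> are the left ends of open intervals which together with them carry
  all of \<open>M\<close>. The bound concerns the open intervals, so a point \<open>t j\<close> may carry arbitrarily large mass.\<close>

definition small_partition :: "nat \<Rightarrow> (nat \<Rightarrow> real) \<Rightarrow> (nat \<Rightarrow> real) \<Rightarrow> real \<Rightarrow> bool" where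
  "small_partition m t u \<delta> \<longleftrightarrow> 0 \<le> \<delta> \<and> disjoint_family_on (\<lambda>j. {t j<..<u j}) {..<m} \<and>
     (AE x in M. \<exists>j<m. x = t j \<or> x \<in> {t j<..<u j}) \<and>
     (\<forall>j<m. measure M {t j<..<u j} * measure N {t j<..<u j} \<le> \<delta>)"

text \<open>For \<open>x\<close> in the interval that starts at \<open>t j\<close> the value \<open>f x\<close> is the integral of \<open>F\<close> over
  \<open>(t j, x]\<close>, which stays inside that open interval. Cauchy--Schwarz bounds its square by the \<open>N\<close>-mass of the interval times the
  energy there; integrating in \<open>x\<close> contributes the \<open>M\<close>-mass, and the energies of disjoint
  intervals add up to at most the total.\<close>

lemma poincare_vanishing_at_points:
  assumes F: "bounded_borel F" and f: "\<And>x. f x = a + primitive_N F x" and p: "small_partition m t u \<delta>"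
    and zero: "\<And>j. j < m \<Longrightarrow> f (t j) = 0"
  shows "(\<integral>x. (f x)\<^sup>2 \<partial>M) \<le> \<delta> * (\<integral>y. (F y)\<^sup>2 \<partial>N)"
proof -
  let ?I = "\<lambda>j. {t j<..<u j}"
  have FF: "bounded_borel (\<lambda>y. (F y)\<^sup>2)" unfolding power2_eq_square by (intro bounded_borel_mult F)
  have [measurable]: "F \<in> borel_measurable borel" using F by (simp add: bounded_borel_def)
  define E where "E j = (\<integral>y. indicator (?I j) y * (F y)\<^sup>2 \<partial>N)" for j
  have intE: "integrable N (\<lambda>y. indicator A y * (F y)\<^sup>2)" if "A \<in> sets borel" for A
    using integrable_mult_indicator[OF _ integrable_bounded_borel(2)[OF FF], of A] that by simp
  have E0: "0 \<le> E j" for j unfolding E_def by (intro Bochner_Integration.integral_nonneg) auto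
  have local: "(f x)\<^sup>2 \<le> measure N (?I j) * E j" if "j < m" "x \<in> ?I j" for x j
  proof -
    have "f x = primitive_N F x - primitive_N F (t j)" using zero[OF that(1)] by (simp add: f)
    also have "\<dots> = (\<integral>y. indicator {t j<..x} y * F y \<partial>N)" by (rule primitive_N_diff[OF F]) (use that in auto)
    finally have "(f x)\<^sup>2 \<le> measure N {t j<..x} * (\<integral>y. indicator {t j<..x} y * (F y)\<^sup>2 \<partial>N)"
      using N.Cauchy_Schwarz_integral_on_set[of "{t j<..x}" F] integrable_bounded_borel(2)[OF FF] integrable_bounded_borel(2)[OF F] by simp
    also have "\<dots> \<le> measure N (?I j) * E j"
      unfolding E_def using that
      by (intro mult_mono N.finite_measure_mono integral_mono intE Bochner_Integration.integral_nonneg)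
        (auto split: split_indicator)
    finally show ?thesis .
  qed
  have ff: "bounded_borel (\<lambda>x. (f x)\<^sup>2)"
    unfolding power2_eq_square f
    by (intro bounded_borel_mult bounded_borel_add bounded_borel_const bounded_borel_primitive_N integrable_bounded_borel F)
  have "(\<integral>x. (f x)\<^sup>2 \<partial>M) \<le> (\<integral>x. (\<Sum>j<m. (measure N (?I j) * E j) * indicator (?I j) x) \<partial>M)"
  proof (rule integral_mono_AE)
    show "integrable M (\<lambda>x. (f x)\<^sup>2)" by (rule integrable_bounded_borel[OF ff])
    show "integrable M (\<lambda>x. \<Sum>j<m. (measure N (?I j) * E j) * indicator (?I j) x)"
      by (intro Bochner_Integration.integrable_sum integrable_mult_right integrable_real_indicator)
        (auto simp: less_top[symmetric])
    have "AE x in M. \<exists>j<m. x = t j \<or> x \<in> ?I j" using p by (simp add: small_partition_def)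
    then show "AE x in M. (f x)\<^sup>2 \<le> (\<Sum>j<m. (measure N (?I j) * E j) * indicator (?I j) x)"
    proof eventually_elim
      case (elim x)
      then obtain j where j: "j < m" and "x = t j \<or> x \<in> ?I j" by blast
      then consider "x = t j" | "x \<in> ?I j" by blast
      then show ?case
      proof cases
        case 1
        then show ?thesis using zero[OF j] E0 by (auto intro!: sum_nonneg)
      next
        case 2
        then have "(f x)\<^sup>2 \<le> (measure N (?I j) * E j) * indicator (?I j) x" using local[OF j] by simp
        also have "\<dots> \<le> (\<Sum>j<m. (measure N (?I j) * E j) * indicator (?I j) x)"
          using j E0 by (intro member_le_sum[of j "{..<m}"]) auto
        finally show ?thesis .
      qed
    qed
  qed
  also have "\<dots> = (\<Sum>j<m. measure N (?I j) * E j * measure M (?I j))"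
    by (subst Bochner_Integration.integral_sum) (auto simp: less_top[symmetric])
  also have "\<dots> \<le> (\<Sum>j<m. \<delta> * E j)"
  proof (rule sum_mono)
    fix j assume "j \<in> {..<m}"
    then have "E j * (measure M (?I j) * measure N (?I j)) \<le> E j * \<delta>"
      using p E0 unfolding small_partition_def by (meson lessThan_iff mult_left_mono)
    then show "measure N (?I j) * E j * measure M (?I j) \<le> \<delta> * E j" by (metis mult.commute mult.left_commute)
  qed
  also have "\<dots> = \<delta> * (\<Sum>j<m. E j)" by (simp add: sum_distrib_left)
  also have "\<dots> \<le> \<delta> * (\<integral>y. (F y)\<^sup>2 \<partial>N)"
  proof -
    have "0 \<le> \<delta>" using p by (simp add: small_partition_def)
    moreover have "(\<Sum>j<m. E j) = (\<integral>y. (\<Sum>j<m. indicator (?I j) y * (F y)\<^sup>2) \<partial>N)"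
      unfolding E_def by (subst Bochner_Integration.integral_sum) (auto intro!: intE)
    moreover have "\<dots> \<le> (\<integral>y. (F y)\<^sup>2 \<partial>N)"
    proof (intro integral_mono Bochner_Integration.integrable_sum intE integrable_bounded_borel FF)
      fix y
      have "(\<Sum>j<m. indicator (?I j) y) = (indicator (\<Union>j<m. ?I j) y :: real)"
        using p by (intro indicator_UN_disjoint[symmetric]) (auto simp: small_partition_def)
      then show "(\<Sum>j<m. indicator (?I j) y * (F y)\<^sup>2) \<le> (F y)\<^sup>2"
        unfolding sum_distrib_right[symmetric] by (auto split: split_indicator)
    qed auto
    ultimately show ?thesis by (intro mult_left_mono) auto
  qed
  finally show ?thesis .
qed

section \<open>The dimension count\<close>

text \<open>Among \<open>card I > m\<close> modes some nontrivial combination \<open>f\<close> vanishes at the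
  \<open>m\<close> points. By orthogonality \<open>\<integral> f\<^sup>2 = \<Sum> Q \<mu>\<close> and the energy is \<open>\<Sum> \<mu> * Q \<mu>\<close>, where \<open>Q \<mu>\<close> is the
  squared norm of the part of \<open>f\<close> in the eigenspace of \<open>\<mu>\<close>. The energy is therefore at most
  \<open>\<Lambda> \<integral> f\<^sup>2\<close>, and the Poincare inequality gives \<open>\<integral> f\<^sup>2 \<le> \<delta> * \<Lambda> * \<integral> f\<^sup>2\<close>. Independence
  inside each eigenspace suffices to make \<open>\<integral> f\<^sup>2\<close> positive.\<close>

lemma eigenvalue_lower_bound_of_partition:
  fixes lam :: "'i \<Rightarrow> real"
  assumes I: "finite I" "m < card I" and p: "small_partition m t u \<delta>"
    and modes: "\<And>i. i \<in> I \<Longrightarrow> mode (lam i) (r i) (F i)"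
    and le: "\<And>i. i \<in> I \<Longrightarrow> lam i \<le> \<Lambda>"
    and indep: "\<And>\<mu> c. AE x in M. (\<Sum>i | i \<in> I \<and> lam i = \<mu>. c i * r i x) = 0 \<Longrightarrow>
        \<forall>i\<in>I. lam i = \<mu> \<longrightarrow> c i = 0"
  shows "1 \<le> \<delta> * \<Lambda>"
proof -
  obtain c where c: "\<exists>i\<in>I. c i \<noteq> 0" "\<And>j. j < m \<Longrightarrow> (\<Sum>i\<in>I. c i * r i (t j)) = 0"
    using underdetermined_system_nontrivial_solution[OF I, of "\<lambda>i j. r i (t j)"] by auto
  define f where "f x = (\<Sum>i\<in>I. c i * r i x)" for x
  define G where "G y = (\<Sum>i\<in>I. c i * F i y)" for y
  define J where "J \<mu> = {i \<in> I. lam i = \<mu>}" for \<mu>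
  define A where "A i k = (\<integral>x. r i x * r k x \<partial>M)" for i k
  define Q where "Q \<mu> = (\<integral>x. (\<Sum>i\<in>J \<mu>. c i * r i x)\<^sup>2 \<partial>M)" for \<mu>
  have bd: "bounded_borel (r i)" "bounded_borel (F i)" if "i \<in> I" for i
    using mode_bounded[OF modes[OF that]] .
  have "\<forall>i\<in>I. \<exists>a. \<forall>x. r i x = a + primitive_N (F i) x" using modes by (auto simp: mode_def)
  then obtain \<alpha> where \<alpha>: "\<And>i x. i \<in> I \<Longrightarrow> r i x = \<alpha> i + primitive_N (F i) x" by metis
  have primG: "primitive_N G x = (\<Sum>i\<in>I. c i * primitive_N (F i) x)" for x
  proof -
    have "primitive_N G x = (\<integral>y. (\<Sum>i\<in>I. c i * (if y \<le> x then F i y else 0)) \<partial>N)"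
      unfolding primitive_N_def G_def by (intro Bochner_Integration.integral_cong refl) auto
    also have "\<dots> = (\<Sum>i\<in>I. c i * primitive_N (F i) x)"
      unfolding primitive_N_def
      by (subst Bochner_Integration.integral_sum)
        (auto intro!: integrable_mult_right integrable_restrict[OF integrable_bounded_borel(2)[OF bd(2)]])
    finally show ?thesis .
  qed
  have f_eq: "f x = (\<Sum>i\<in>I. c i * \<alpha> i) + primitive_N G x" for x
    unfolding f_def primG sum.distrib[symmetric] by (intro sum.cong refl) (simp add: \<alpha> algebra_simps)
  have bG: "bounded_borel G"
    unfolding G_def by (intro bounded_borel_sum bounded_borel_mult bounded_borel_const bd)
  have poinc: "(\<integral>x. (f x)\<^sup>2 \<partial>M) \<le> \<delta> * (\<integral>y. (G y)\<^sup>2 \<partial>N)"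
    by (rule poincare_vanishing_at_points[OF bG f_eq p]) (simp add: f_def c)
  have Qsum: "Q \<mu> = (\<Sum>i\<in>J \<mu>. \<Sum>k\<in>I. c i * c k * A i k)" for \<mu>
  proof -
    have "Q \<mu> = (\<Sum>i\<in>J \<mu>. \<Sum>k\<in>J \<mu>. c i * c k * A i k)"
      unfolding Q_def A_def using I(1)
      by (intro integral_square_sum integrable_bounded_borel bounded_borel_mult bd) (auto simp: J_def)
    also have "\<dots> = (\<Sum>i\<in>J \<mu>. \<Sum>k\<in>I. c i * c k * A i k)"
    proof (rule sum.cong[OF refl])
      fix i assume i: "i \<in> J \<mu>"
      have "c i * c k * A i k = 0" if "k \<in> I - J \<mu>" for k
      proof -
        have "A i k = 0"
          unfolding A_def using i that by (intro mode_orthogonal[OF modes modes]) (auto simp: J_def)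
        then show ?thesis by simp
      qed
      then show "(\<Sum>k\<in>J \<mu>. c i * c k * A i k) = (\<Sum>k\<in>I. c i * c k * A i k)"
        by (intro sum.mono_neutral_left[OF I(1)] ballI) (auto simp: J_def)
    qed
    finally show ?thesis .
  qed
  have fQ: "(\<integral>x. (f x)\<^sup>2 \<partial>M) = (\<Sum>\<mu>\<in>lam ` I. Q \<mu>)"
  proof -
    have "(\<integral>x. (f x)\<^sup>2 \<partial>M) = (\<Sum>i\<in>I. \<Sum>k\<in>I. c i * c k * A i k)"
      unfolding f_def A_def by (intro integral_square_sum integrable_bounded_borel bounded_borel_mult bd I)
    also have "\<dots> = (\<Sum>\<mu>\<in>lam ` I. Q \<mu>)"
      unfolding Qsum J_def using I(1) by (intro sum.group[symmetric]) auto
    finally show ?thesis .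
  qed
  have GQ: "(\<integral>y. (G y)\<^sup>2 \<partial>N) = (\<Sum>\<mu>\<in>lam ` I. \<mu> * Q \<mu>)"
  proof -
    have "(\<integral>y. (G y)\<^sup>2 \<partial>N) = (\<Sum>i\<in>I. \<Sum>k\<in>I. c i * c k * (\<integral>y. F i y * F k y \<partial>N))"
      unfolding G_def by (intro integral_square_sum integrable_bounded_borel bounded_borel_mult bd I)
    also have "\<dots> = (\<Sum>i\<in>I. lam i * (\<Sum>k\<in>I. c i * c k * A i k))"
      unfolding A_def sum_distrib_left
      by (intro sum.cong refl) (simp add: mode_energy[OF modes modes])
    also have "\<dots> = (\<Sum>\<mu>\<in>lam ` I. \<Sum>i\<in>J \<mu>. lam i * (\<Sum>k\<in>I. c i * c k * A i k))"
      unfolding J_def using I(1) by (intro sum.group[symmetric]) auto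
    also have "\<dots> = (\<Sum>\<mu>\<in>lam ` I. \<mu> * Q \<mu>)"
      unfolding Qsum sum_distrib_left by (intro sum.cong refl) (auto simp: J_def)
    finally show ?thesis .
  qed
  have Q0: "0 \<le> Q \<mu>" for \<mu> unfolding Q_def by (intro Bochner_Integration.integral_nonneg) auto
  have "0 < (\<Sum>\<mu>\<in>lam ` I. Q \<mu>)"
  proof (rule ccontr)
    assume "\<not> ?thesis"
    then have "(\<Sum>\<mu>\<in>lam ` I. Q \<mu>) = 0" using sum_nonneg[of "lam ` I" Q] Q0 by fastforce
    then have Qz: "Q \<mu> = 0" if "\<mu> \<in> lam ` I" for \<mu>
      using that I(1) Q0 by (subst (asm) sum_nonneg_eq_0_iff) auto
    \<comment> \<open>A vanishing square norm makes every eigencomponent of \<open>f\<close> vanish, against the choice of \<open>c\<close>.\<close>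
    have "c i = 0" if "i \<in> I" for i
    proof -
      have int: "integrable M (\<lambda>x. (\<Sum>i\<in>J (lam i). c i * r i x)\<^sup>2)"
        unfolding power2_eq_square
        by (intro integrable_bounded_borel bounded_borel_mult bounded_borel_sum bounded_borel_const bd) (auto simp: J_def)
      have "AE x in M. (\<Sum>i\<in>J (lam i). c i * r i x)\<^sup>2 = 0"
        using Qz[of "lam i"] that integral_nonneg_eq_0_iff_AE[OF int] unfolding Q_def by auto
      then have "AE x in M. (\<Sum>i' | i' \<in> I \<and> lam i' = lam i. c i' * r i' x) = 0" by (simp add: J_def)
      from indep[OF this] that show ?thesis by auto
    qed
    with c(1) show False by blast
  qed
  moreover have "(\<Sum>\<mu>\<in>lam ` I. Q \<mu>) \<le> \<delta> * \<Lambda> * (\<Sum>\<mu>\<in>lam ` I. Q \<mu>)"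
  proof -
    have "(\<Sum>\<mu>\<in>lam ` I. \<mu> * Q \<mu>) \<le> (\<Sum>\<mu>\<in>lam ` I. \<Lambda> * Q \<mu>)"
      using le Q0 by (intro sum_mono mult_right_mono) auto
    then have "\<delta> * (\<Sum>\<mu>\<in>lam ` I. \<mu> * Q \<mu>) \<le> \<delta> * (\<Lambda> * (\<Sum>\<mu>\<in>lam ` I. Q \<mu>))"
      using p by (intro mult_left_mono) (auto simp: small_partition_def sum_distrib_left)
    then show ?thesis using poinc unfolding fQ GQ by (simp add: mult.assoc)
  qed
  ultimately show ?thesis by (simp add: mult_le_cancel_right2)
qed

end

section \<open>The measures of the torus\<close>

definition torus_dV :: "(real \<Rightarrow> real) \<Rightarrow> real measure" where
  "torus_dV V = density (dV V) (indicator {0..<1})"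

definition torus_dW :: "(real \<Rightarrow> real) \<Rightarrow> real measure" where
  "torus_dW W = density (dW W) (indicator {0<..1})"

lemma sets_dV [simp, measurable_cong]: "sets (dV V) = sets borel"
  by (simp add: dV_def)

lemma borel_measurable_dV [simp]: "borel_measurable (dV V) = borel_measurable borel"
  by (rule measurable_cong_sets) simp_all

lemma borel_measurable_dW [simp]: "borel_measurable (dW V) = borel_measurable borel"
  by (rule measurable_cong_sets) simp_all

lemma sets_torus [simp]: "sets (torus_dV V) = sets borel" "sets (torus_dW W) = sets borel"
  by (simp_all add: torus_dV_def torus_dW_def)

lemma space_torus [simp]: "space (torus_dV V) = UNIV" "space (torus_dW W) = UNIV"
  by (simp_all add: torus_dV_def torus_dW_def dV_def)

lemma emeasure_torus:
  assumes "A \<in> sets borel"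
  shows "emeasure (torus_dV V) A = emeasure (dV V) ({0..<1} \<inter> A)"
    "emeasure (torus_dW W) A = emeasure (dW W) ({0<..1} \<inter> A)"
  using assms by (simp_all add: torus_dV_def torus_dW_def emeasure_restricted)

lemma integral_torus:
  fixes f :: "real \<Rightarrow> real"
  assumes "f \<in> borel_measurable borel"
  shows "(\<integral>x. f x \<partial>torus_dV V) = (\<integral>x. indicator {0..<1} x * f x \<partial>dV V)"
    "(\<integral>x. f x \<partial>torus_dW W) = (\<integral>x. indicator {0<..1} x * f x \<partial>dW W)"
    "integrable (torus_dV V) f \<longleftrightarrow> integrable (dV V) (\<lambda>x. indicator {0..<1} x * f x)"
  using assms integral_density[of f "dV V" "indicator {0..<1}"] integral_density[of f "dW W" "indicator {0<..1}"]
    integrable_density[of f "dV V" "indicator {0..<1}"]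
  by (simp_all add: torus_dV_def torus_dW_def ennreal_indicator)

lemma AE_torus: "(AE x in torus_dV V. P x) \<longleftrightarrow> (AE x\<in>torus in dV V. P x)"
  unfolding torus_dV_def by (subst AE_density) (auto simp: indicator_def)

lemma admissibleD:
  assumes "admissible W V"
  shows "mono W" "mono V" "cadlag W" "caglad V" "W 0 = 0" "V 0 = 0" "0 < W 1" "0 < V 1"
  using assms strict_monoD[of W 0 1] strict_monoD[of V 0 1] by (auto simp: admissible_def strict_mono_mono)

lemma two_finite_measures_torus:
  assumes "admissible W V" shows "two_finite_measures (torus_dV V) (torus_dW W)"
proof -
  note a = admissibleD[OF assms]
  have "finite_measure (torus_dV V)"
    by (rule finite_measureI) (simp add: emeasure_torus emeasure_dV[OF a(2,4)])
  moreover have "finite_measure (torus_dW W)"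
    by (rule finite_measureI) (simp add: emeasure_torus emeasure_dW[OF a(1,3)])
  ultimately show ?thesis by (simp add: two_finite_measures_def two_finite_measures_axioms_def)
qed

text \<open>The passage from closed subintervals to the open interval isolates the only
  limit in the construction of the partition: on closed subintervals the masses can be read off from
  \<open>W\<close> and \<open>V\<close> at points inside the interval, where no one-sided limits at its ends appear.\<close>

lemma emeasure_open_interval_le:
  assumes K: "sets K = sets borel" and le: "\<And>x y. p < x \<Longrightarrow> x \<le> y \<Longrightarrow> y < q \<Longrightarrow> emeasure K {x..y} \<le> \<epsilon>"
  shows "emeasure K {p<..<q::real} \<le> \<epsilon>"
proof (cases "p < q")
  case True
  then have pq: "ereal p < ereal q" by simp
  obtain u l where ul: "einterval (ereal p) (ereal q) = (\<Union>i. {l i .. u i})"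
    "incseq u" "decseq l" "\<And>i. l i < u i" "\<And>i. ereal p < l i" "\<And>i. u i < ereal q"
    by (rule einterval_Icc_approximation[OF pq]) blast
  have "incseq (\<lambda>i. {l i..u i})"
    using ul(2,3) by (auto simp: incseq_def decseq_def intro: order_trans)
  then have "emeasure K (\<Union>i. {l i..u i}) = (SUP i. emeasure K {l i..u i})"
    by (rule SUP_emeasure_incseq[symmetric, rotated]) (simp add: K image_subset_iff)
  also have "\<dots> \<le> \<epsilon>"
  proof (rule SUP_least)
    fix i show "emeasure K {l i..u i} \<le> \<epsilon>"
      using ul(4)[of i] ul(5)[of i] ul(6)[of i] by (intro le) simp_all
  qed
  finally show ?thesis by (simp add: ul(1)[symmetric] einterval_eq)
qed auto

text \<open>The points \<open>t j\<close> are quantiles of \<open>U = W / W 1 + V / V 1\<close>, which increases from \<open>0\<close> to \<open>2\<close>. Strictly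
  between consecutive quantiles \<open>U\<close> varies by at most \<open>2 / m\<close>, and since \<open>W\<close> and \<open>V\<close>
  both increase, each of \<open>W / W 1\<close> and \<open>V / V 1\<close> varies by at most that much. A jump of \<open>U\<close>
  larger than this can only sit at a quantile.\<close>

lemma small_partition_exists:
  assumes adm: "admissible W V" and m: "0 < m"
  shows "\<exists>t u. two_finite_measures.small_partition (torus_dV V) (torus_dW W) m t u (4 * V 1 * W 1 / (real m)\<^sup>2)"
proof -
  note a = admissibleD[OF adm]
  interpret two_finite_measures "torus_dV V" "torus_dW W" by (rule two_finite_measures_torus[OF adm])
  define U where "U x = W x / W 1 + V x / V 1" for x
  have U_mono: "U x \<le> U y" if "x \<le> y" for x y
    unfolding U_def using monoD[OF a(1) that] monoD[OF a(2) that] a(7,8)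
    by (intro add_mono divide_right_mono) simp_all
  have U0: "U 0 = 0" and U1: "U 1 = 2" using a by (auto simp: U_def)
  have U_pos: "0 < U x" if "0 < x" for x
  proof -
    have "strict_mono W" "strict_mono V" using adm by (auto simp: admissible_def)
    then have "0 < W x" "0 < V x" using that a(5,6) by (metis strict_monoD)+
    then show ?thesis using a unfolding U_def by (intro add_pos_pos divide_pos_pos)
  qed
  define S where "S j = {x \<in> {0..1}. U x \<le> 2 * real j / real m}" for j :: nat
  \<comment> \<open>The condition \<open>x \<in> {0..1}\<close> in \<open>S\<close> makes \<open>t 0 = 0\<close> and \<open>t m = 1\<close>, so the intervals exhaust the torus.\<close>
  define t where "t j = Sup (S j)" for j :: nat
  have bdd: "bdd_above (S j)" for j by (auto simp: S_def bdd_above_def)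
  have zero: "0 \<in> S j" for j by (auto simp: S_def U0)
  have t_mono: "t i \<le> t j" if "i \<le> j" for i j
    unfolding t_def
  proof (intro cSup_subset_mono bdd)
    have "2 * real i / real m \<le> 2 * real j / real m" using that by (intro divide_right_mono) auto
    then show "S i \<subseteq> S j" by (auto simp: S_def)
  qed (use zero in blast)
  have t_ge: "0 \<le> t j" for j unfolding t_def by (rule cSup_upper[OF zero bdd])
  have t_le: "t j \<le> 1" for j unfolding t_def
  proof (rule cSup_least)
    show "S j \<noteq> {}" using zero by blast
  qed (simp add: S_def)
  have below: "U x \<le> 2 * real j / real m" if "x < t j" for x j
  proof -
    from that obtain y where "y \<in> S j" "x < y" unfolding t_def using less_cSup_iff[OF _ bdd] zero by blast
    then show ?thesis using U_mono[of x y] by (auto simp: S_def)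
  qed
  have above: "2 * real j / real m < U x" if "t j < x" "x \<le> 1" for x j
  proof (rule ccontr)
    assume "\<not> ?thesis"
    then have "x \<in> S j" using that t_ge[of j] by (auto simp: S_def)
    then show False using cSup_upper[OF _ bdd] that(1) unfolding t_def by fastforce
  qed
  have t0: "t 0 = 0"
  proof -
    have "x = 0" if "x \<in> S 0" for x
      using U_pos[of x] that by (cases "x = 0") (auto simp: S_def)
    then have "S 0 = {0}" using zero[of 0] by blast
    then show ?thesis by (simp add: t_def)
  qed
  have tm: "t m = 1"
  proof -
    have "1 \<in> S m" using m by (simp add: S_def U1)
    then show ?thesis using cSup_upper[OF _ bdd, of 1 m] t_le[of m] by (simp add: t_def)
  qed
  let ?I = "\<lambda>j. {t j<..<t (Suc j)}"
  have osc: "W y - W x \<le> 2 * W 1 / m \<and> V y - V x \<le> 2 * V 1 / m"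
    if "t j < x" "x \<le> y" "y < t (Suc j)" for x y j
  proof -
    have "U y - U x \<le> 2 * real (Suc j) / real m - 2 * real j / real m"
      using below[OF that(3)] above[OF that(1)] that t_le[of "Suc j"] by fastforce
    also have "\<dots> = 2 / m" by (simp add: diff_divide_distrib[symmetric] algebra_simps)
    finally have "(W y - W x) / W 1 + (V y - V x) / V 1 \<le> 2 / m" by (simp add: U_def diff_divide_distrib)
    moreover have "0 \<le> (W y - W x) / W 1" "0 \<le> (V y - V x) / V 1"
      using monoD[OF a(1) that(2)] monoD[OF a(2) that(2)] a(7,8) by simp_all
    ultimately have "(W y - W x) / W 1 \<le> 2 / m" "(V y - V x) / V 1 \<le> 2 / m" by linarith+
    then show ?thesis using a by (simp add: pos_divide_le_eq)
  qed
  have mW: "measure (torus_dW W) (?I j) \<le> 2 * W 1 / m" for j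
  proof -
    have "emeasure (torus_dW W) (?I j) \<le> ennreal (2 * W 1 / m)"
    proof (rule emeasure_open_interval_le)
      fix x y assume xy: "t j < x" "x \<le> y" "y < t (Suc j)"
      then obtain x' where x': "t j < x'" "x' < x" using dense by blast
      have "emeasure (torus_dW W) {x..y} \<le> emeasure (dW W) {x'<..y}"
        using x' by (subst emeasure_torus) (auto intro!: emeasure_mono)
      also have "\<dots> = ennreal (W y - W x')" using x' xy by (intro emeasure_dW a) auto
      also have "\<dots> \<le> ennreal (2 * W 1 / m)" using osc[of j x' y] x' xy by (intro ennreal_leI) auto
      finally show "emeasure (torus_dW W) {x..y} \<le> ennreal (2 * W 1 / m)" .
    qed simp
    then show ?thesis using a by (simp add: measure_def enn2real_leI)
  qed
  have mV: "measure (torus_dV V) (?I j) \<le> 2 * V 1 / m" for j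
  proof -
    have "emeasure (torus_dV V) (?I j) \<le> ennreal (2 * V 1 / m)"
    proof (rule emeasure_open_interval_le)
      fix x y assume xy: "t j < x" "x \<le> y" "y < t (Suc j)"
      then obtain y' where y': "y < y'" "y' < t (Suc j)" using dense by blast
      have "emeasure (torus_dV V) {x..y} \<le> emeasure (dV V) {x..<y'}"
        using y' by (subst emeasure_torus) (auto intro!: emeasure_mono)
      also have "\<dots> = ennreal (V y' - V x)" using y' xy by (intro emeasure_dV a) auto
      also have "\<dots> \<le> ennreal (2 * V 1 / m)" using osc[of j x y'] y' xy by (intro ennreal_leI) auto
      finally show "emeasure (torus_dV V) {x..y} \<le> ennreal (2 * V 1 / m)" .
    qed simp
    then show ?thesis using a by (simp add: measure_def enn2real_leI)
  qed
  have "small_partition m t (\<lambda>j. t (Suc j)) (4 * V 1 * W 1 / (real m)\<^sup>2)"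
    unfolding small_partition_def
  proof (intro conjI allI impI)
    show "0 \<le> 4 * V 1 * W 1 / (real m)\<^sup>2" using a by auto
    show "disjoint_family_on ?I {..<m}"
    proof (unfold disjoint_family_on_def, intro ballI impI)
      fix i j :: nat assume "i \<noteq> j"
      then consider "Suc i \<le> j" | "Suc j \<le> i" by linarith
      then show "?I i \<inter> ?I j = {}"
        by cases (use t_mono[of "Suc i" j] t_mono[of "Suc j" i] in auto)
    qed
    have "\<exists>j<m. x = t j \<or> x \<in> ?I j" if "x \<in> {0..<1}" for x
    proof -
      \<comment> \<open>Quantiles may coincide at a jump of \<open>U\<close>; the last one that does not exceed \<open>x\<close> is the right one.\<close>
      define j where "j = Max {j. j < m \<and> t j \<le> x}"
      have fin: "finite {j. j < m \<and> t j \<le> x}" by simp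
      have "0 \<in> {j. j < m \<and> t j \<le> x}" using m t0 that by auto
      then have "j \<in> {j. j < m \<and> t j \<le> x}" unfolding j_def by (intro Max_in[OF fin]) (rule ex_in_conv[THEN iffD1, OF exI])
      then have j: "j < m" "t j \<le> x" by simp_all
      have "x < t (Suc j)"
      proof (cases "Suc j < m")
        case True
        show ?thesis
        proof (rule ccontr)
          assume "\<not> ?thesis"
          then have "Suc j \<le> j" using True Max_ge[OF fin, of "Suc j"] by (simp add: j_def[symmetric])
          then show False by simp
        qed
      next
        case False
        then have "Suc j = m" using j by simp
        then show ?thesis using tm that by simp
      qed
      then have "x = t j \<or> x \<in> ?I j" using j(2) by auto
      then show ?thesis using j(1) by blast
    qed
    then show "AE x in torus_dV V. \<exists>j<m. x = t j \<or> x \<in> ?I j" unfolding AE_torus by (intro AE_I2 impI)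
    fix j assume "j < m"
    have "measure (torus_dV V) (?I j) * measure (torus_dW W) (?I j) \<le> (2 * V 1 / m) * (2 * W 1 / m)"
      using a by (intro mult_mono mV mW) auto
    then show "measure (torus_dV V) (?I j) * measure (torus_dW W) (?I j) \<le> 4 * V 1 * W 1 / (real m)\<^sup>2"
      by (simp add: power2_eq_square)
  qed
  then show ?thesis by blast
qed

section \<open>Quadratic growth of the eigenvalues\<close>

text \<open>The integral equation defines \<open>F\<close> and then \<open>r\<close> from the values of \<open>e\<close> on the torus.
  As \<open>r\<close> agrees with \<open>e\<close> almost everywhere, \<open>e\<close> may be replaced by \<open>r\<close> under the inner integral.
  The closing condition at \<open>1\<close> becomes mean zero of \<open>F\<close>, and mean zero of \<open>- \<mu> * e\<close> becomes mean zero
  of \<open>r\<close>, because \<open>\<mu>\<close> is positive.\<close>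

lemma eigenfunction_mode:
  assumes adm: "admissible W V" and \<mu>: "0 < \<mu>" and e: "e \<in> eigenspace W V \<mu>"
  shows "\<exists>r F. two_finite_measures.mode (torus_dV V) (torus_dW W) \<mu> r F \<and> (AE x in torus_dV V. r x = e x)"
proof -
  note adm_simps = admissibleD[OF adm]
  interpret two_finite_measures "torus_dV V" "torus_dW W" by (rule two_finite_measures_torus[OF adm])
  from e obtain a b where
    eL2: "e \<in> L2 V" and mean: "(LINT x:torus|dV V. - \<mu> * e x) = 0"
    and rep: "AE x\<in>torus in dV V. e x = a + b * W x + iterated_integral W V (\<lambda>x. - \<mu> * e x) x"
    and per: "b * W 1 + iterated_integral W V (\<lambda>x. - \<mu> * e x) 1 = 0"
    by (auto simp: eigenspace_def has_laplacian_def L2_0_def)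
  \<comment> \<open>Only \<open>e\<close> restricted to the torus is known to be measurable.\<close>
  define g where "g x = indicator torus x * e x" for x
  have g_meas [measurable]: "g \<in> borel_measurable borel"
    using eL2 by (simp add: L2_def set_borel_measurable_def g_def[abs_def])
  have "integrable (torus_dV V) (\<lambda>x. (g x)\<^sup>2)"
  proof -
    have "set_integrable (dV V) torus (\<lambda>x. (e x)\<^sup>2)" using eL2 by (simp add: L2_def)
    also have "?this \<longleftrightarrow> integrable (dV V) (\<lambda>x. indicator torus x * (g x)\<^sup>2)"
      unfolding set_integrable_def
      by (intro Bochner_Integration.integrable_cong refl) (auto simp: g_def split: split_indicator)
    finally show ?thesis by (subst integral_torus) simp_all
  qed
  then have g_int: "integrable (torus_dV V) g"
    by (rule M.square_integrable_imp_integrable[rotated]) simp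
  have primM_g: "(LINT s:{0..<y}|dV V. - \<mu> * e s) = - \<mu> * primitive_M g y" if "y \<le> 1" for y
  proof -
    have "primitive_M g y = (\<integral>s. indicator {0..<1} s * (if s < y then g s else 0) \<partial>dV V)"
      unfolding primitive_M_def by (rule integral_torus) simp
    also have "\<dots> = (\<integral>s. indicator {0..<y} s * e s \<partial>dV V)"
      using that by (intro Bochner_Integration.integral_cong refl) (auto simp: g_def split: split_indicator)
    finally show ?thesis
      by (simp add: set_lebesgue_integral_def mult.left_commute[of "indicator _ _"])
  qed
  define G where "G = primitive_M g"
  have [measurable]: "G \<in> borel_measurable borel" unfolding G_def by simp
  have bG: "bounded_borel G" unfolding G_def by (rule bounded_borel_primitive_M[OF g_int])
  define F where "F y = b - \<mu> * G y" for y
  have [measurable]: "F \<in> borel_measurable borel" unfolding F_def[abs_def] by simp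
  have bF: "bounded_borel F"
    using bounded_borel_add[OF bounded_borel_const bounded_borel_mult[OF bounded_borel_const bG], of b "- \<mu>"]
    by (simp add: F_def[abs_def])
  have primN_F: "primitive_N F x = b * W x + iterated_integral W V (\<lambda>x. - \<mu> * e x) x" if x: "0 \<le> x" "x \<le> 1" for x
  proof -
    have "primitive_N F x = (\<integral>y. b * (if y \<le> x then 1 else 0) + - \<mu> * (if y \<le> x then G y else 0) \<partial>torus_dW W)"
      unfolding primitive_N_def by (intro Bochner_Integration.integral_cong refl) (simp add: F_def)
    also have "\<dots> = b * (\<integral>y. (if y \<le> x then 1 else 0) \<partial>torus_dW W) + - \<mu> * (\<integral>y. (if y \<le> x then G y else 0) \<partial>torus_dW W)"
      using integrable_restrict[OF integrable_bounded_borel(2)[OF bG], of "\<lambda>y. y \<le> x"]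
        integrable_restrict[OF integrable_bounded_borel(2)[OF bounded_borel_const[of 1]], of "\<lambda>y. y \<le> x"]
      by (subst Bochner_Integration.integral_add) (simp_all del: mult_minus_left)
    also have "(\<integral>y. (if y \<le> x then 1 else 0 :: real) \<partial>torus_dW W) = (\<integral>y. indicator {0<..x} y \<partial>dW W)"
      using x by (subst integral_torus, measurable)
        (intro Bochner_Integration.integral_cong refl, auto split: split_indicator)
    also have "\<dots> = W x"
      using x adm_simps(5) monoD[OF adm_simps(1) x(1)] emeasure_dW[OF adm_simps(1,3), of 0 x]
      by (simp add: measure_def)
    also have "- \<mu> * (\<integral>y. (if y \<le> x then G y else 0) \<partial>torus_dW W) = (\<integral>y. indicator {0<..x} y * (- \<mu> * G y) \<partial>dW W)"
      using x unfolding integral_mult_right_zero[symmetric]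
      by (subst integral_torus, measurable)
        (intro Bochner_Integration.integral_cong refl, auto split: split_indicator)
    also have "\<dots> = iterated_integral W V (\<lambda>x. - \<mu> * e x) x"
      unfolding iterated_integral_def set_lebesgue_integral_def[of "dW W"]
    proof (intro Bochner_Integration.integral_cong refl)
      fix y
      show "indicator {0<..x} y * (- \<mu> * G y) = indicator {0<..x} y *\<^sub>R (LINT s:{0..<y}|dV V. - \<mu> * e s)"
      proof (cases "y \<in> {0<..x}")
        case True
        then have "(LINT s:{0..<y}|dV V. - \<mu> * e s) = - \<mu> * G y"
          unfolding G_def using x by (intro primM_g) simp
        then show ?thesis by (simp only: real_scaleR_def)
      qed simp
    qed
    finally show ?thesis .
  qed
  define r where "r x = a + primitive_N F x" for x
  have r_e: "AE x in torus_dV V. r x = e x"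
    using rep unfolding AE_torus by eventually_elim (auto simp: r_def primN_F)
  have r_g: "AE x in torus_dV V. r x = g x"
    using r_e unfolding AE_torus by eventually_elim (auto simp: g_def)
  have [measurable]: "r \<in> borel_measurable borel" unfolding r_def[abs_def] by simp
  have primM_r: "primitive_M r y = G y" for y
    unfolding primitive_M_def G_def
  proof (rule integral_cong_AE)
    show "AE s in torus_dV V. (if s < y then r s else 0) = (if s < y then g s else 0)"
      using r_g by eventually_elim simp
  qed simp_all
  have "\<exists>a b. (\<forall>x. r x = a + primitive_N F x) \<and> (\<forall>y. F y = b - \<mu> * primitive_M r y)"
    by (intro exI[of _ a] exI[of _ b]) (simp add: r_def F_def primM_r)
  moreover have "(\<integral>x. r x \<partial>torus_dV V) = 0"
  proof -
    have "(\<integral>x. r x \<partial>torus_dV V) = (\<integral>x. g x \<partial>torus_dV V)"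
      using r_g by (intro integral_cong_AE) simp_all
    also have "\<dots> = (LINT x:torus|dV V. e x)"
      unfolding set_lebesgue_integral_def
      by (subst integral_torus) (auto intro!: Bochner_Integration.integral_cong simp: g_def split: split_indicator)
    also have "\<dots> = 0" using mean \<mu> by (simp add: set_lebesgue_integral_def mult.left_commute[of "indicator _ _"])
    finally show ?thesis .
  qed
  moreover have "(\<integral>y. F y \<partial>torus_dW W) = 0"
  proof -
    have "(\<integral>y. F y \<partial>torus_dW W) = primitive_N F 1"
      unfolding primitive_N_def by (subst (1 2) integral_torus) (auto intro!: Bochner_Integration.integral_cong split: split_indicator)
    then show ?thesis using primN_F[of 1] per by simp
  qed
  moreover have "integrable (torus_dV V) r"
    using g_int r_g by (subst integrable_cong_AE[of r _ g]) simp_all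
  ultimately have "mode \<mu> r F" unfolding mode_def by blast
  with r_e show ?thesis by blast
qed

text \<open>Reindexing a basis by the positions at which an eigenvalue occurs assigns one
  eigenfunction to each term of the sequence of eigenvalues.\<close>

lemma has_dim_L2_indexed:
  assumes "has_dim_L2 V E (card S)" "finite S"
  shows "\<exists>e. (\<forall>i\<in>S. e i \<in> E) \<and>
    (\<forall>c :: 'i \<Rightarrow> real. (AE x\<in>torus in dV V. (\<Sum>i\<in>S. c i * e i x) = 0) \<longrightarrow> (\<forall>i\<in>S. c i = 0))"
proof -
  obtain h where h: "bij_betw h S {..<card S}"
    using ex_bij_betw_finite_nat[OF assms(2)] by (auto simp: atLeast0LessThan)
  from assms(1) obtain b where b: "\<forall>k<card S. b k \<in> E"
    "\<And>c :: nat \<Rightarrow> real. (AE x\<in>torus in dV V. (\<Sum>k<card S. c k * b k x) = 0) \<Longrightarrow> \<forall>k<card S. c k = 0"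
    unfolding has_dim_L2_def by blast
  have "\<forall>i\<in>S. c i = 0" if "AE x\<in>torus in dV V. (\<Sum>i\<in>S. c i * b (h i) x) = 0" for c :: "'i \<Rightarrow> real"
  proof -
    have "(\<Sum>i\<in>S. c i * b (h i) x) = (\<Sum>k<card S. c (inv_into S h k) * b k x)" for x
      using h by (subst sum.reindex_bij_betw[OF h, symmetric]) (auto simp: bij_betw_def inv_into_f_f intro!: sum.cong)
    then have "\<forall>k<card S. c (inv_into S h k) = 0" using b(2) that by simp
    then show ?thesis using h by (metis bij_betwE bij_betw_inv_into_left lessThan_iff)
  qed
  moreover have "\<forall>i\<in>S. b (h i) \<in> E" using b(1) h by (auto simp: bij_betw_def)
  ultimately show ?thesis by (intro exI[of _ "\<lambda>i. b (h i)"]) blast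
qed

text \<open>The dimension count with the first \<open>m + 1\<close> eigenfunctions and the partition at
  \<open>m\<close> quantiles.\<close>

lemma eigenvalue_quadratic_step:
  assumes adm: "admissible W V" and pe: "positive_eigenvalues W V lam" and m: "0 < m"
  shows "(real m)\<^sup>2 \<le> 4 * V 1 * W 1 * lam (Suc m)"
proof -
  interpret two_finite_measures "torus_dV V" "torus_dW W" by (rule two_finite_measures_torus[OF adm])
  define S where "S \<mu> = {i. 1 \<le> i \<and> lam i = \<mu>}" for \<mu>
  have "\<exists>e. (\<forall>i\<in>S \<mu>. e i \<in> eigenspace W V \<mu>) \<and>
    (\<forall>c :: nat \<Rightarrow> real. (AE x\<in>torus in dV V. (\<Sum>i\<in>S \<mu>. c i * e i x) = 0) \<longrightarrow> (\<forall>i\<in>S \<mu>. c i = 0))"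
    if "0 < \<mu>" for \<mu>
  proof (rule has_dim_L2_indexed)
    show "has_dim_L2 V (eigenspace W V \<mu>) (card (S \<mu>))" "finite (S \<mu>)"
      using pe that unfolding S_def positive_eigenvalues_def by blast+
  qed
  then have "\<exists>B. \<forall>\<mu>>0. (\<forall>i\<in>S \<mu>. B \<mu> i \<in> eigenspace W V \<mu>) \<and>
    (\<forall>c :: nat \<Rightarrow> real. (AE x\<in>torus in dV V. (\<Sum>i\<in>S \<mu>. c i * B \<mu> i x) = 0) \<longrightarrow> (\<forall>i\<in>S \<mu>. c i = 0))"
    by (intro choice allI) blast
  then obtain B where B: "\<And>\<mu> i. 0 < \<mu> \<Longrightarrow> i \<in> S \<mu> \<Longrightarrow> B \<mu> i \<in> eigenspace W V \<mu>"
    "\<And>\<mu> (c :: nat \<Rightarrow> real) i. 0 < \<mu> \<Longrightarrow> (AE x\<in>torus in dV V. (\<Sum>i\<in>S \<mu>. c i * B \<mu> i x) = 0) \<Longrightarrow> i \<in> S \<mu> \<Longrightarrow> c i = 0"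
    by blast
  define I where "I = {1..Suc m}"
  have pos: "0 < lam i" if "i \<in> I" for i using pe that by (auto simp: positive_eigenvalues_def I_def)
  have "\<exists>r F. mode (lam i) r F \<and> (AE x in torus_dV V. r x = B (lam i) i x)" if "i \<in> I" for i
    using eigenfunction_mode[OF adm pos[OF that] B(1)[OF pos[OF that]]] that by (auto simp: S_def I_def)
  then obtain r F where rF: "\<And>i. i \<in> I \<Longrightarrow> mode (lam i) (r i) (F i)"
    "\<And>i. i \<in> I \<Longrightarrow> AE x in torus_dV V. r i x = B (lam i) i x" by metis
  obtain t u where p: "small_partition m t u (4 * V 1 * W 1 / (real m)\<^sup>2)" using small_partition_exists[OF adm m] by blast
  have "1 \<le> 4 * V 1 * W 1 / (real m)\<^sup>2 * lam (Suc m)"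
  proof (rule eigenvalue_lower_bound_of_partition[OF _ _ p rF(1)])
    show "finite I" "m < card I" by (auto simp: I_def)
    show "lam i \<le> lam (Suc m)" if "i \<in> I" for i
      using pe that unfolding positive_eigenvalues_def I_def by (auto intro: mono_onD[of "{1..}" lam])
    fix \<mu> c assume ae: "AE x in torus_dV V. (\<Sum>i | i \<in> I \<and> lam i = \<mu>. c i * r i x) = 0"
    show "\<forall>i\<in>I. lam i = \<mu> \<longrightarrow> c i = 0"
    proof (intro ballI impI)
      fix i assume i: "i \<in> I" "lam i = \<mu>"
      have \<mu>: "0 < \<mu>" using pos[OF i(1)] i(2) by simp
      have fin: "finite (S \<mu>)" using pe \<mu> by (auto simp: positive_eigenvalues_def S_def)
      have "AE x in torus_dV V. \<forall>i\<in>I. r i x = B (lam i) i x"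
        using rF(2) by (intro AE_finite_allI) (auto simp: I_def)
      with ae have "AE x in torus_dV V. (\<Sum>i\<in>S \<mu>. (if i \<in> I then c i else 0) * B \<mu> i x) = 0"
      proof eventually_elim
        case (elim x)
        have "(\<Sum>i\<in>S \<mu>. (if i \<in> I then c i else 0) * B \<mu> i x) = (\<Sum>i | i \<in> I \<and> lam i = \<mu>. c i * r i x)"
          using fin elim(2) by (intro sum.mono_neutral_cong_right) (auto simp: S_def I_def)
        then show ?case using elim(1) by simp
      qed
      from B(2)[OF \<mu> this[unfolded AE_torus], of i] i show "c i = 0" by (auto simp: S_def I_def)
    qed
  qed
  then show ?thesis using m by (simp add: field_simps)
qed

lemma eigenvalue_quadratic_growth:
  assumes adm: "admissible W V" and pe: "positive_eigenvalues W V lam"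
  shows "\<exists>C>0. \<forall>n\<ge>1. C * (real n)\<^sup>2 \<le> lam n"
proof -
  \<comment> \<open>For \<open>n = m + 1 \<ge> 2\<close> one has \<open>n \<le> 2 * m\<close>, which turns the constant \<open>4\<close> into \<open>16\<close>; \<open>n = 1\<close> is absorbed by taking \<open>C \<le> lam 1\<close>.\<close>
  define K where "K = 16 * V 1 * W 1"
  have K: "0 < K" using admissibleD[OF adm] by (simp add: K_def)
  have lam1: "0 < lam 1" using pe by (auto simp: positive_eigenvalues_def)
  define C where "C = min (lam 1) (1 / K)"
  have "C * (real n)\<^sup>2 \<le> lam n" if n: "1 \<le> n" for n
  proof (cases "n = 1")
    case False
    then obtain m where m: "n = Suc m" "0 < m" using n by (cases n) auto
    have "(real n)\<^sup>2 \<le> (2 * real m)\<^sup>2" using m by (intro power_mono) auto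
    also have "\<dots> \<le> K * lam n"
      using eigenvalue_quadratic_step[OF adm pe m(2)] m(1) by (simp add: K_def power_mult_distrib)
    finally have "1 / K * (real n)\<^sup>2 \<le> lam n" using K by (simp add: field_simps)
    moreover have "C * (real n)\<^sup>2 \<le> 1 / K * (real n)\<^sup>2" by (intro mult_right_mono) (auto simp: C_def)
    ultimately show ?thesis by linarith
  qed (simp add: C_def)
  moreover have "0 < C" using K lam1 by (simp add: C_def)
  ultimately show ?thesis by blast
qed

section \<open>The Lebesgue case\<close>

lemma admissible_id: "admissible (\<lambda>x. x) (\<lambda>x. x)"
  unfolding admissible_def cadlag_def caglad_def
  by (auto simp: strict_mono_def intro: tendsto_ident_at)

lemma dW_id: "dW (\<lambda>x. x) = lborel" by (rule lborel_eq_real[symmetric])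

lemma dV_id: "dV (\<lambda>x. x) = lborel"
  by (simp add: dV_def lborel_eq_real[symmetric] lborel_distr_uminus)

text \<open>The rotation by the angle \<open>\<omega> * x\<close> that undoes the motion of the pair
  \<open>(r, F / \<omega>)\<close> makes it constant; rotating back gives the solution.\<close>

lemma harmonic_oscillator:
  fixes r F :: "real \<Rightarrow> real"
  assumes r: "\<And>x. x \<in> {0..1} \<Longrightarrow> (r has_real_derivative F x) (at x within {0..1})"
    and F: "\<And>x. x \<in> {0..1} \<Longrightarrow> (F has_real_derivative - (\<omega>\<^sup>2) * r x) (at x within {0..1})"
    and \<omega>: "0 < \<omega>" and x: "x \<in> {0..1}"
  shows "r x = r 0 * cos (\<omega> * x) + F 0 / \<omega> * sin (\<omega> * x)"
    "F x / \<omega> = F 0 / \<omega> * cos (\<omega> * x) - r 0 * sin (\<omega> * x)"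
proof -
  define P where "P x = r x * cos (\<omega> * x) - F x / \<omega> * sin (\<omega> * x)" for x
  define Q where "Q x = r x * sin (\<omega> * x) + F x / \<omega> * cos (\<omega> * x)" for x
  have \<omega>0: "\<omega> \<noteq> 0" using \<omega> by simp
  \<comment> \<open>\<open>(P, Q)\<close> is \<open>(r, F / \<omega>)\<close> rotated back by the angle \<open>\<omega> * x\<close>.\<close>
  have P': "(P has_real_derivative 0) (at x within {0..1})" if "x \<in> {0..1}" for x
    unfolding P_def[abs_def]
    by (rule derivative_eq_intros r F that \<omega>0 refl)+ (use \<omega> in \<open>simp add: field_simps power2_eq_square\<close>)
  have Q': "(Q has_real_derivative 0) (at x within {0..1})" if "x \<in> {0..1}" for x
    unfolding Q_def[abs_def]
    by (rule derivative_eq_intros r F that \<omega>0 refl)+ (use \<omega> in \<open>simp add: field_simps power2_eq_square\<close>)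
  have "\<exists>c. \<forall>x\<in>{0..1}. P x = c" "\<exists>c. \<forall>x\<in>{0..1}. Q x = c"
    using has_field_derivative_zero_constant[of "{0..1}" P] has_field_derivative_zero_constant[of "{0..1}" Q] P' Q'
    by (auto simp: Ball_def)
  then have "P x = P 0" "Q x = Q 0" using x by force+
  then have P: "P x = r 0" and Q: "Q x = F 0 / \<omega>" by (simp_all add: P_def Q_def)
  have rotate: "u = p * c + q * s \<and> v = q * c - p * s"
    if "p = u * c - v * s" "q = u * s + v * c" "c * c + s * s = 1" for u v p q c s :: real
    using that by algebra
  show "r x = r 0 * cos (\<omega> * x) + F 0 / \<omega> * sin (\<omega> * x)"
    "F x / \<omega> = F 0 / \<omega> * cos (\<omega> * x) - r 0 * sin (\<omega> * x)"
    using rotate[OF P[symmetric, unfolded P_def] Q[symmetric, unfolded Q_def]] by simp_all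
qed

text \<open>For Lebesgue measure the two integral equations of a mode may be differentiated,
  which gives the oscillator equation on \<open>[0, 1]\<close>. Periodicity says that the rotation by \<open>\<omega>\<close> fixes
  the vector \<open>(A, B)\<close> of initial data, so either the vector or the angle is trivial.\<close>

lemma lebesgue_eigenfunction:
  assumes e: "e \<in> eigenspace (\<lambda>x. x) (\<lambda>x. x) (\<omega>\<^sup>2)" and \<omega>: "0 < \<omega>"
  shows "\<exists>A B. (AE x\<in>torus in lborel. e x = A * cos (\<omega> * x) + B * sin (\<omega> * x)) \<and>
    (cos \<omega> = 1 \<or> A = 0 \<and> B = 0)"
proof -
  let ?id = "\<lambda>x::real. x"
  interpret two_finite_measures "torus_dV ?id" "torus_dW ?id"
    by (rule two_finite_measures_torus[OF admissible_id])
  from eigenfunction_mode[OF admissible_id _ e] \<omega> obtain r F where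
    mode: "mode (\<omega>\<^sup>2) r F" and re: "AE x in torus_dV ?id. r x = e x" by auto
  from mode obtain a b where a: "\<And>x. r x = a + primitive_N F x" and b: "\<And>y. F y = b - \<omega>\<^sup>2 * primitive_M r y"
    and means: "(\<integral>x. r x \<partial>torus_dV ?id) = 0" "(\<integral>y. F y \<partial>torus_dW ?id) = 0"
    unfolding mode_def by blast
  note bd = mode_bounded[OF mode]
  have [measurable]: "r \<in> borel_measurable borel" "F \<in> borel_measurable borel"
    using bd by (auto simp: bounded_borel_def)
  have set_int: "set_integrable lborel {0..x} f" if "bounded_borel f" for f and x :: real
  proof -
    from that obtain B where B: "\<And>x. \<bar>f x\<bar> \<le> B" and [measurable]: "f \<in> borel_measurable borel"
      by (auto simp: bounded_borel_def)
    show ?thesis unfolding set_integrable_def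
      by (rule integrableI_bounded_set_indicator[of _ _ _ B]) (use B in \<open>auto simp: emeasure_lborel_Icc_eq\<close>)
  qed
  have primitive_N: "primitive_N F x = integral {0..x} F" if "x \<in> {0..1}" for x
  proof -
    have "primitive_N F x = (\<integral>y. indicator {0<..1} y * (if y \<le> x then F y else 0) \<partial>lborel)"
      unfolding primitive_N_def by (subst integral_torus(2)) (simp_all add: dW_id)
    also have "\<dots> = (LINT y:{0..x}|lborel. F y)"
      unfolding set_lebesgue_integral_def
    proof (rule integral_cong_AE)
      show "AE y in lborel. indicator {0<..1} y * (if y \<le> x then F y else 0) = indicator {0..x} y *\<^sub>R F y"
        using AE_lborel_singleton[of 0] by eventually_elim (use that in \<open>auto split: split_indicator\<close>)
    qed simp_all
    also have "\<dots> = integral {0..x} F" by (rule set_borel_integral_eq_integral[OF set_int[OF bd(2)]])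
    finally show ?thesis .
  qed
  have primitive_M: "primitive_M r x = integral {0..x} r" if "x \<in> {0..1}" for x
  proof -
    have "primitive_M r x = (\<integral>y. indicator {0..<1} y * (if y < x then r y else 0) \<partial>lborel)"
      unfolding primitive_M_def by (subst integral_torus(1)) (simp_all add: dV_id)
    also have "\<dots> = (LINT y:{0..x}|lborel. r y)"
      unfolding set_lebesgue_integral_def
    proof (rule integral_cong_AE)
      show "AE y in lborel. indicator {0..<1} y * (if y < x then r y else 0) = indicator {0..x} y *\<^sub>R r y"
        using AE_lborel_singleton[of x] by eventually_elim (use that in \<open>auto split: split_indicator\<close>)
    qed simp_all
    also have "\<dots> = integral {0..x} r" by (rule set_borel_integral_eq_integral[OF set_int[OF bd(1)]])
    finally show ?thesis .
  qed
  have cont_r: "continuous_on {0..1} r"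
  proof -
    have "continuous_on {0..1} (\<lambda>x. a + integral {0..x} F)"
      by (intro continuous_intros indefinite_integral_continuous_1 set_borel_integral_eq_integral(1) set_int bd)
    then show ?thesis using continuous_on_cong[of "{0..1}" "{0..1}" r] by (auto simp: a primitive_N)
  qed
  have F': "(F has_real_derivative - (\<omega>\<^sup>2) * r x) (at x within {0..1})" if "x \<in> {0..1}" for x
  proof (rule has_field_derivative_transform_within[OF _ zero_less_one that])
    show "((\<lambda>x. b - \<omega>\<^sup>2 * integral {0..x} r) has_real_derivative - (\<omega>\<^sup>2) * r x) (at x within {0..1})"
      by (rule derivative_eq_intros integral_has_real_derivative[OF cont_r that] refl)+ simp
  qed (simp add: b primitive_M)
  then have "continuous_on {0..1} F"
    unfolding continuous_on_eq_continuous_within using DERIV_continuous by blast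
  have r': "(r has_real_derivative F x) (at x within {0..1})" if "x \<in> {0..1}" for x
  proof (rule has_field_derivative_transform_within[OF _ zero_less_one that])
    show "((\<lambda>x. a + integral {0..x} F) has_real_derivative F x) (at x within {0..1})"
      by (rule derivative_eq_intros integral_has_real_derivative[OF \<open>continuous_on {0..1} F\<close> that] refl)+ simp
  qed (simp add: a primitive_N)
  note sol = harmonic_oscillator[OF r' F' \<omega>]
  have "primitive_N F 1 = (\<integral>y. F y \<partial>torus_dW ?id)"
    unfolding primitive_N_def by (subst (1 2) integral_torus(2)) (auto intro!: Bochner_Integration.integral_cong split: split_indicator)
  then have r1: "r 1 = r 0" using means(2) primitive_N[of 0] by (simp add: a)
  have "primitive_M r 1 = (\<integral>y. r y \<partial>torus_dV ?id)"
    unfolding primitive_M_def by (subst (1 2) integral_torus(1)) (auto intro!: Bochner_Integration.integral_cong split: split_indicator)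
  then have F1: "F 1 = F 0" using means(1) primitive_M[of 0] by (simp add: b)
  define A B where "A = r 0" and "B = F 0 / \<omega>"
  have "A = A * cos \<omega> + B * sin \<omega>" "B = B * cos \<omega> - A * sin \<omega>"
    using sol(1)[of 1, unfolded r1 mult_1_right] sol(2)[of 1, unfolded F1 mult_1_right]
    unfolding A_def B_def by (metis atLeastAtMost_iff order_refl zero_le_one)+
  \<comment> \<open>Take the inner product of the fixed-point equation with \<open>(A, B)\<close>.\<close>
  then have "(A\<^sup>2 + B\<^sup>2) * (1 - cos \<omega>) = 0" by algebra
  then have "cos \<omega> = 1 \<or> A = 0 \<and> B = 0" by (auto simp: sum_power2_eq_zero_iff)
  moreover have "AE x\<in>torus in lborel. e x = A * cos (\<omega> * x) + B * sin (\<omega> * x)"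
    using re unfolding AE_torus dV_id
  proof eventually_elim
    case (elim x)
    then show ?case using sol(1)[of x] by (auto simp: A_def B_def)
  qed
  ultimately show ?thesis by blast
qed

text \<open>Two applications of the fundamental theorem of calculus; the constants of
  integration are \<open>f 0\<close> and \<open>f' 0\<close>.\<close>

lemma smooth_eigenfunction:
  assumes f: "\<And>x. (f has_real_derivative f' x) (at x)" and f': "\<And>x. (f' has_real_derivative - \<mu> * f x) (at x)"
    and per: "f 1 = f 0" "f' 1 = f' 0"
  shows "f \<in> eigenspace (\<lambda>x. x) (\<lambda>x. x) \<mu>"
proof -
  have cont: "continuous_on S f" "continuous_on S f'" for S
    using f f' by (meson DERIV_continuous continuous_at_imp_continuous_on)+
  have [measurable]: "f \<in> borel_measurable borel"
    using cont(1) by (rule borel_measurable_continuous_onI)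
  have inner: "(LINT s:{0..<y}|lborel. - \<mu> * f s) = f' y - f' 0" if "0 \<le> y" for y
  proof -
    have "(LINT s:{0..<y}|lborel. - \<mu> * f s) = (LBINT s=ereal 0..ereal y. - \<mu> * f s)"
      using that by (intro interval_integral_Ico[symmetric]) simp
    also have "\<dots> = f' y - f' 0"
      by (intro interval_integral_FTC_finite continuous_intros cont)
        (metis f' has_real_derivative_iff_has_vector_derivative has_vector_derivative_at_within)
    finally show ?thesis .
  qed
  have outer: "iterated_integral (\<lambda>x. x) (\<lambda>x. x) (\<lambda>x. - \<mu> * f x) x = f x - f 0 - x * f' 0" if "0 \<le> x" for x
  proof -
    have "iterated_integral (\<lambda>x. x) (\<lambda>x. x) (\<lambda>x. - \<mu> * f x) x = (LINT y:{0<..x}|lborel. f' y - f' 0)"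
      unfolding iterated_integral_def dW_id dV_id
      by (rule set_lebesgue_integral_cong) (simp, intro allI impI inner, simp)
    also have "\<dots> = (LBINT y=ereal 0..ereal x. f' y - f' 0)"
      using that by (intro interval_integral_Ioc[symmetric]) simp
    also have "\<dots> = (f x - x * f' 0) - (f 0 - 0 * f' 0)"
    proof (intro interval_integral_FTC_finite continuous_intros cont)
      fix y
      have "((\<lambda>x. f x - x * f' 0) has_real_derivative f' y - f' 0) (at y)"
        by (rule derivative_eq_intros f refl)+ simp
      then show "((\<lambda>x. f x - x * f' 0) has_vector_derivative f' y - f' 0) (at y within {min 0 x..max 0 x})"
        by (simp add: has_real_derivative_iff_has_vector_derivative has_vector_derivative_at_within)
    qed
    finally show ?thesis by simp
  qed
  have bdd: "set_integrable lborel {0..<1} g" if "continuous_on {0..1} g" for g :: "real \<Rightarrow> real"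
    using borel_integrable_atLeastAtMost'[OF that] by (rule set_integrable_subset) auto
  have L2: "f \<in> L2 (\<lambda>x. x)" "(\<lambda>x. - \<mu> * f x) \<in> L2 (\<lambda>x. x)"
    unfolding L2_def dV_id set_borel_measurable_def
    by (auto intro!: bdd continuous_intros cont simp del: mult_minus_left)
  moreover have "(LINT s:torus|dV (\<lambda>x. x). - \<mu> * f s) = 0"
    using inner[of 1] per by (simp add: dV_id)
  moreover have "AE x\<in>torus in dV (\<lambda>x. x). f x = f 0 + f' 0 * x + iterated_integral (\<lambda>x. x) (\<lambda>x. x) (\<lambda>x. - \<mu> * f x) x"
    using outer by (intro AE_I2) (simp add: mult.commute)
  moreover have "f' 0 * 1 + iterated_integral (\<lambda>x. x) (\<lambda>x. x) (\<lambda>x. - \<mu> * f x) 1 = 0"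
    using outer[of 1] per by simp
  ultimately show ?thesis
    unfolding eigenspace_def has_laplacian_def L2_0_def by blast
qed

lemma AE_torus_continuous_eq_0:
  assumes ae: "AE x\<in>torus in lborel. h x = 0" and h: "continuous_on UNIV h" and x: "0 < x" "x < 1"
  shows "h x = (0 :: real)"
proof (rule ccontr)
  assume "h x \<noteq> 0"
  define U where "U = {0<..<1} \<inter> h -` (- {0})"
  have "open U" unfolding U_def using h by (intro open_Int open_vimage) auto
  then have U: "U \<in> sets lborel" by simp
  have "AE x in lborel. x \<notin> U" using ae by eventually_elim (auto simp: U_def)
  then have "U \<in> null_sets lborel" using AE_iff_null_sets[OF U] by blast
  then have "negligible U" by (simp add: negligible_iff_null_sets null_sets_completionI)
  moreover have "U \<noteq> {}" using x \<open>h x \<noteq> 0\<close> by (auto simp: U_def)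
  ultimately show False using open_not_negligible[OF \<open>open U\<close>] by blast
qed

text \<open>Rounding up \<open>i / 2\<close> lists every \<open>k \<ge> 1\<close> twice, once for the cosine and once for
  the sine.\<close>

definition periodic_eigenvalue :: "nat \<Rightarrow> real" where
  "periodic_eigenvalue i = (2 * pi * real ((i + 1) div 2))\<^sup>2"

lemma periodic_eigenvalue_positions:
  assumes "0 < k" shows "{i. 1 \<le> i \<and> periodic_eigenvalue i = (2 * pi * real k)\<^sup>2} = {2 * k - 1, 2 * k}"
proof -
  have "periodic_eigenvalue i = (2 * pi * real k)\<^sup>2 \<longleftrightarrow> (i + 1) div 2 = k" for i
    unfolding periodic_eigenvalue_def using power2_eq_iff_nonneg[of "2 * pi * real ((i + 1) div 2)" "2 * pi * real k"] by simp
  moreover obtain j where j: "k = Suc j" using assms by (cases k) auto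
  have "1 \<le> i \<and> (i + 1) div 2 = Suc j \<longleftrightarrow> i = 2 * j + 1 \<or> i = 2 * j + 2" for i
    by presburger
  ultimately show ?thesis by (auto simp: j)
qed

text \<open>If \<open>cos \<omega> = 1\<close> then \<open>\<omega> = 2 \<pi> k\<close>, and cosine and sine span the
  eigenspace of \<open>\<omega>\<^sup>2\<close>. They are told apart at \<open>1 / (4 k)\<close> and \<open>1 / (2 k)\<close>, where the argument
  \<open>\<omega> x\<close> is \<open>\<pi> / 2\<close> and \<open>\<pi>\<close>. Otherwise every element of the eigenspace vanishes almost everywhere and
  \<open>\<omega>\<^sup>2\<close> is not in the list.\<close>

lemma positive_eigenvalues_id: "positive_eigenvalues (\<lambda>x. x) (\<lambda>x. x) periodic_eigenvalue"
  unfolding positive_eigenvalues_def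
proof (intro conjI allI impI)
  show "0 < periodic_eigenvalue i" if "1 \<le> i" for i
  proof -
    have "1 \<le> (i + 1) div 2" using that by presburger
    then show ?thesis by (simp add: periodic_eigenvalue_def)
  qed
  show "mono_on {1..} periodic_eigenvalue"
    unfolding periodic_eigenvalue_def by (intro mono_onI power_mono mult_left_mono of_nat_mono div_le_mono) auto
  fix \<mu> :: real assume \<mu>: "0 < \<mu>"
  define \<omega> where "\<omega> = sqrt \<mu>"
  have \<omega>: "0 < \<omega>" "\<mu> = \<omega>\<^sup>2" using \<mu> by (simp_all add: \<omega>_def)
  let ?S = "{i. 1 \<le> i \<and> periodic_eigenvalue i = \<mu>}"
  have "finite ?S \<and> has_dim_L2 (\<lambda>x. x) (eigenspace (\<lambda>x. x) (\<lambda>x. x) \<mu>) (card ?S)"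
  proof (cases "cos \<omega> = 1")
    case True
    then obtain k :: nat where "\<omega> = real k * 2 * pi \<or> \<omega> = - (real k * 2 * pi)"
      unfolding cos_one_2pi by blast
    moreover have "0 \<le> real k * 2 * pi" by simp
    ultimately have "\<omega> = real k * 2 * pi" using \<omega>(1) by linarith
    then have k: "\<omega> = 2 * pi * real k" by simp
    then have kpos: "0 < k" using \<omega>(1) by (cases k) auto
    then have S: "?S = {2 * k - 1, 2 * k}" using periodic_eigenvalue_positions[of k] by (simp add: \<omega>(2) k)
    define e where "e i x = (if i = 0 then cos (\<omega> * x) else sin (\<omega> * x))" for i :: nat and x
    have "sin \<omega> = 0" using True sin_cos_squared_add[of \<omega>] by simp
    have "e i \<in> eigenspace (\<lambda>x. x) (\<lambda>x. x) \<mu>" for i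
    proof (cases "i = 0")
      case i: True
      show ?thesis
        by (rule smooth_eigenfunction[where f' = "\<lambda>x. - \<omega> * sin (\<omega> * x)"])
          (auto simp: e_def[abs_def] i \<omega>(2) True \<open>sin \<omega> = 0\<close> power2_eq_square intro!: derivative_eq_intros)
    next
      case i: False
      show ?thesis
        by (rule smooth_eigenfunction[where f' = "\<lambda>x. \<omega> * cos (\<omega> * x)"])
          (auto simp: e_def[abs_def] i \<omega>(2) True \<open>sin \<omega> = 0\<close> power2_eq_square intro!: derivative_eq_intros)
    qed
    moreover have "c 0 = 0 \<and> c 1 = 0" if "AE x\<in>torus in lborel. (\<Sum>i<2. c i * e i x) = 0" for c :: "nat \<Rightarrow> real"
    proof -
      have ae: "AE x\<in>torus in lborel. c 0 * cos (\<omega> * x) + c 1 * sin (\<omega> * x) = 0"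
        using that by (simp add: e_def numeral_2_eq_2)
      have z: "c 0 * cos (\<omega> * x) + c 1 * sin (\<omega> * x) = 0" if "0 < x" "x < 1" for x
        by (rule AE_torus_continuous_eq_0[OF ae _ that]) (intro continuous_intros)
      have quarter: "\<omega> * (1 / (4 * real k)) = pi / 2" and half: "\<omega> * (1 / (2 * real k)) = pi"
        using kpos by (simp_all add: k)
      have lt: "0 < 1 / (4 * real k)" "1 / (4 * real k) < 1" "0 < 1 / (2 * real k)" "1 / (2 * real k) < 1"
        using kpos by (simp_all add: field_simps)
      have "c 0 * cos (pi / 2) + c 1 * sin (pi / 2) = 0" "c 0 * cos pi + c 1 * sin pi = 0"
        using z[OF lt(1,2)] z[OF lt(3,4)] unfolding quarter half by blast+
      then show ?thesis by simp
    qed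
    moreover have "\<exists>c. AE x\<in>torus in lborel. f x = (\<Sum>i<2. c i * e i x)"
      if "f \<in> eigenspace (\<lambda>x. x) (\<lambda>x. x) \<mu>" for f
    proof -
      from lebesgue_eigenfunction[of f \<omega>] that \<omega> obtain A B
        where "AE x\<in>torus in lborel. f x = A * cos (\<omega> * x) + B * sin (\<omega> * x)" by auto
      then show ?thesis
        by (intro exI[of _ "\<lambda>i::nat. if i = 0 then A else B"]) (simp add: e_def numeral_2_eq_2)
    qed
    ultimately have "has_dim_L2 (\<lambda>x. x) (eigenspace (\<lambda>x. x) (\<lambda>x. x) \<mu>) 2"
      unfolding has_dim_L2_def dV_id by (intro exI[of _ e]) (auto simp: less_2_cases_iff)
    moreover have "card ?S = 2" unfolding S using kpos by simp
    ultimately show ?thesis using S by simp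
  next
    case False
    have "periodic_eigenvalue i \<noteq> \<mu>" for i
    proof
      assume "periodic_eigenvalue i = \<mu>"
      then have "2 * pi * real ((i + 1) div 2) = \<omega>"
        unfolding periodic_eigenvalue_def \<omega>(2) using \<omega>(1) by (subst (asm) power2_eq_iff_nonneg) auto
      then have "cos \<omega> = 1" unfolding cos_one_2pi by (intro disjI1 exI[of _ "(i + 1) div 2"]) (simp add: mult_ac)
      with False show False by simp
    qed
    then have S: "?S = {}" by auto
    have "AE x\<in>torus in lborel. f x = 0" if "f \<in> eigenspace (\<lambda>x. x) (\<lambda>x. x) \<mu>" for f
      using lebesgue_eigenfunction[of f \<omega>] that \<omega> False by auto
    then show ?thesis unfolding S has_dim_L2_def dV_id by simp
  qed
  then show "finite ?S" "has_dim_L2 (\<lambda>x. x) (eigenspace (\<lambda>x. x) (\<lambda>x. x) \<mu>) (card ?S)" by blast+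
qed

lemma periodic_eigenvalue_bounds:
  shows "pi\<^sup>2 * (real n)\<^sup>2 \<le> periodic_eigenvalue n" "1 \<le> n \<Longrightarrow> periodic_eigenvalue n \<le> 4 * pi\<^sup>2 * (real n)\<^sup>2"
proof -
  have "n \<le> 2 * ((n + 1) div 2)" by presburger
  then have "real n \<le> 2 * real ((n + 1) div 2)" by linarith
  then have "pi * real n \<le> pi * (2 * real ((n + 1) div 2))" by (intro mult_left_mono) auto
  then have "(pi * real n)\<^sup>2 \<le> (2 * pi * real ((n + 1) div 2))\<^sup>2" by (intro power_mono) (auto simp: mult_ac)
  then show "pi\<^sup>2 * (real n)\<^sup>2 \<le> periodic_eigenvalue n" by (simp add: periodic_eigenvalue_def power_mult_distrib)
  assume "1 \<le> n"
  then have "(n + 1) div 2 \<le> n" by presburger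
  then have "(2 * pi * real ((n + 1) div 2))\<^sup>2 \<le> (2 * pi * real n)\<^sup>2" by (intro power_mono mult_left_mono) auto
  then show "periodic_eigenvalue n \<le> 4 * pi\<^sup>2 * (real n)\<^sup>2" by (simp add: periodic_eigenvalue_def power_mult_distrib)
qed

section \<open>Summability and the main result\<close>

lemma summable_inverse_powr:
  fixes lam :: "nat \<Rightarrow> real"
  assumes C: "0 < C" and lam: "\<And>n. 1 \<le> n \<Longrightarrow> C * (real n)\<^sup>2 \<le> lam n" and s: "1 / 2 < s"
  shows "summable (\<lambda>i. 1 / lam (Suc i) powr s)"
proof (rule summable_comparison_test')
  have "summable (\<lambda>n. real n powr (- (2 * s)))" using s by (simp add: summable_real_powr_iff)
  then have "summable (\<lambda>n. real (Suc n) powr (- (2 * s)))" by (subst summable_Suc_iff)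
  then show "summable (\<lambda>n. C powr (- s) * real (Suc n) powr (- (2 * s)))" by (rule summable_mult)
  fix n :: nat
  have pos: "0 < C * (real (Suc n))\<^sup>2" using C by simp
  have "1 / lam (Suc n) powr s \<le> 1 / (C * (real (Suc n))\<^sup>2) powr s"
    using s pos lam[of "Suc n"] by (intro divide_left_mono powr_mono2 mult_pos_pos) auto
  also have "\<dots> = C powr (- s) * real (Suc n) powr (- (2 * s))"
    using C by (simp add: powr_mult powr_minus_divide powr_powr flip: powr_numeral)
  finally show "norm (1 / lam (Suc n) powr s) \<le> C powr (- s) * real (Suc n) powr (- (2 * s))" by simp
qed

theorem theorem19:
  shows "(\<forall>W V lam. admissible W V \<longrightarrow> positive_eigenvalues W V lam \<longrightarrow>
            (\<exists>\<rho>. 0 < \<rho> \<and> \<rho> \<le> 1/2 \<and>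
               (\<exists>C>0. \<forall>n\<ge>1. C * real n powr (1 / \<rho>) \<le> lam n) \<and>
               (\<forall>s>\<rho>. summable (\<lambda>i. 1 / lam (Suc i) powr s))))
       \<and> (\<exists>W V lam \<rho>. admissible W V \<and> positive_eigenvalues W V lam \<and>
            0 < \<rho> \<and> \<rho> \<le> 1/2 \<and>
            (\<exists>C>0. \<exists>C'>0. \<forall>n\<ge>1. C * real n powr (1 / \<rho>) \<le> lam n \<and>
                                 lam n \<le> C' * real n powr (1 / \<rho>)) \<and>
            (\<forall>s>\<rho>. summable (\<lambda>i. 1 / lam (Suc i) powr s)))"
proof (intro conjI allI impI)
  fix W V lam assume adm: "admissible W V" and pe: "positive_eigenvalues W V lam"
  obtain C where C: "0 < C" "\<And>n. 1 \<le> n \<Longrightarrow> C * (real n)\<^sup>2 \<le> lam n"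
    using eigenvalue_quadratic_growth[OF adm pe] by blast
  have "C * real n powr (1 / (1 / 2)) \<le> lam n" if "1 \<le> n" for n
    using C(2)[OF that] that by simp
  then have lower: "\<exists>C>0. \<forall>n\<ge>1. C * real n powr (1 / (1 / 2)) \<le> lam n"
    using C(1) by blast
  have summ: "\<forall>s>1 / 2. summable (\<lambda>i. 1 / lam (Suc i) powr s)"
    using summable_inverse_powr[OF C] by blast
  show "\<exists>\<rho>. 0 < \<rho> \<and> \<rho> \<le> 1/2 \<and> (\<exists>C>0. \<forall>n\<ge>1. C * real n powr (1 / \<rho>) \<le> lam n) \<and>
      (\<forall>s>\<rho>. summable (\<lambda>i. 1 / lam (Suc i) powr s))"
    by (rule exI[of _ "1 / 2"], intro conjI lower summ) simp_all
next
  have "pi\<^sup>2 * real n powr (1 / (1 / 2)) \<le> periodic_eigenvalue n \<and> periodic_eigenvalue n \<le> 4 * pi\<^sup>2 * real n powr (1 / (1 / 2))"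
    if "1 \<le> n" for n
    using periodic_eigenvalue_bounds[of n] that by simp
  moreover have "0 < pi\<^sup>2" "0 < 4 * pi\<^sup>2" by simp_all
  ultimately have bounds: "\<exists>C>0. \<exists>C'>0. \<forall>n\<ge>1. C * real n powr (1 / (1 / 2)) \<le> periodic_eigenvalue n \<and>
      periodic_eigenvalue n \<le> C' * real n powr (1 / (1 / 2))"
    by blast
  have summ: "\<forall>s>1 / 2. summable (\<lambda>i. 1 / periodic_eigenvalue (Suc i) powr s)"
    using summable_inverse_powr[OF \<open>0 < pi\<^sup>2\<close> periodic_eigenvalue_bounds(1)] by blast
  show "\<exists>W V lam \<rho>. admissible W V \<and> positive_eigenvalues W V lam \<and> 0 < \<rho> \<and> \<rho> \<le> 1/2 \<and>
      (\<exists>C>0. \<exists>C'>0. \<forall>n\<ge>1. C * real n powr (1 / \<rho>) \<le> lam n \<and> lam n \<le> C' * real n powr (1 / \<rho>)) \<and>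
      (\<forall>s>\<rho>. summable (\<lambda>i. 1 / lam (Suc i) powr s))"
    by (rule exI[of _ "\<lambda>x. x"], rule exI[of _ "\<lambda>x. x"], rule exI[of _ periodic_eigenvalue], rule exI[of _ "1 / 2"],
      intro conjI admissible_id positive_eigenvalues_id bounds summ) simp_all
qed

end
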